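(* Let $n\ge1$, $\varepsilon\in(0,1)$, $t$ real, and set the key length $\ell=n-t+2\log_2\frac1\varepsilon+3$ (assumed an integer with $0\le\ell\le2n$). Then the quantum encryption scheme described in the context is strongly $(t,\varepsilon)$-entropically secure for all functions.
   Context: Let $\mathcal H_A=(\mathbb C^2)^{\otimes n}$, $X=\begin{pmatrix}0&1\\1&0\end{pmatrix}$, $Z=\begin{pmatrix}1&0\\0&-1\end{pmatrix}$; for $\beta=s\|q\in\{0,1\}^{2n}$ let $U_\beta=\bigotimes_{i=1}^nX^{s_i}Z^{q_i}$ and $F_\beta(\rho)=U_\beta\rho U_\beta^\dagger$ (acting on the $A$ system only when other systems are present). Let $\lambda=\max\{\ell,2n-\ell\}$; bit strings are identified with elements of $\mathrm{GF}(2^\lambda)$ via the polynomial representation, and $(w)_{\rm lsb}$ denotes the last $2n-\ell$ bits of $w$. For $k\in\{0,1\}^\ell$, $u\in\{0,1\}^\lambda$, $v\in\{0,1\}^{2n-\ell}$, $b(k,u,v)=k\,\|\,((uk)_{\rm lsb}+v)$ (concatenation; product in $\mathrm{GF}(2^\lambda)$; $+$ is XOR). The scheme: key $k$ uniform in $\{0,1\}^\ell$; encryption of a state $\varphi$ on $\mathcal H_A$ draws $u,v$ uniformly and outputs the classical strings $u,v$ together with the $n$-qubit state $F_{b(k,u,v)}(\varphi)$; decryption applies $F_{b(k,u,v)}$ again. From the viewpoint of someone not knowing the key, the encryption is the channel $R$ mapping $\varphi^{AE}$ to the classical-quantum state $R(\varphi^{AE})=\mathbb E_{u,v}|uv\rangle\langle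 uv|\otimes 2^{-\ell}\sum_kF_{b(k,u,v)}(\varphi^{AE})$ (acting as identity on $E$). Conditional min-entropy: $\mathsf H_{\min}(A|E)_\varphi=\sup_{\sigma_E}-\log_2\min\{\mu:\mu\,\mathbb 1_A\otimes\sigma_E-\varphi^{AE}\ge0\}$, supremum over density operators $\sigma_E$ on $\mathcal H_E$. Strong entropic security: an encryption channel $R$ is strongly $(t,\varepsilon)$-entropically secure if for every finite-dimensional $\mathcal H_E$, every state $\varphi^{AE}$ with $\mathsf H_{\min}(A|E)_\varphi\ge t$, every decomposition (interpretation) $\varphi^{AE}=\sum_ip_i\sigma_i^{AE}$ into a probability distribution $(p_i)$ and states $\sigma_i^{AE}$, every (quantum, unbounded) adversary $\mathcal A$ and every function $f$ of the index $i$, it holds that $\big|\Pr[\mathcal A(R(\sigma_i^{AE}))=f(i)]-\Pr[\mathcal A(R(\varphi^A)\otimes\sigma_i^E)=f(i)]\big|\le\varepsilon$, where $i$ is drawn with probability $p_i$, $\varphi^A=\mathrm{Tr}_E\varphi^{AE}$ and $\sigma_i^E=\mathrm{Tr}_A\sigma_i^{AE}$. *)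

theory Defs
  imports "Jordan_Normal_Form.Matrix" "HOL-Library.Z2" "HOL-Computational_Algebra.Polynomial"
begin

definition mtrace :: "complex mat \<Rightarrow> complex" where
  "mtrace A = (\<Sum>i<dim_row A. A $$ (i, i))"

definition adj :: "complex mat \<Rightarrow> complex mat" where
  "adj A = mat (dim_col A) (dim_row A) (\<lambda>(i, j). cnj (A $$ (j, i)))"

definition kron :: "complex mat \<Rightarrow> complex mat \<Rightarrow> complex mat" where
  "kron A B = mat (dim_row A * dim_row B) (dim_col A * dim_col B)
     (\<lambda>(i, j). A $$ (i div dim_row B, j div dim_col B) * B $$ (i mod dim_row B, j mod dim_col B))"

definition psd :: "nat \<Rightarrow> complex mat \<Rightarrow> bool" where
  "psd d A \<longleftrightarrow> A \<in> carrier_mat d d \<and>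
     (\<forall>v :: nat \<Rightarrow> complex. Im (\<Sum>a<d. \<Sum>b<d. cnj (v a) * A $$ (a, b) * v b) = 0
                          \<and> 0 \<le> Re (\<Sum>a<d. \<Sum>b<d. cnj (v a) * A $$ (a, b) * v b))"

definition density :: "nat \<Rightarrow> complex mat \<Rightarrow> bool" where
  "density d \<rho> \<longleftrightarrow> psd d \<rho> \<and> mtrace \<rho> = 1"

definition ptrace_E :: "nat \<Rightarrow> nat \<Rightarrow> complex mat \<Rightarrow> complex mat" where
  "ptrace_E dA dE \<rho> = mat dA dA (\<lambda>(a, a'). \<Sum>e<dE. \<rho> $$ (a * dE + e, a' * dE + e))"

definition ptrace_A :: "nat \<Rightarrow> nat \<Rightarrow> complex mat \<Rightarrow> complex mat" where
  "ptrace_A dA dE \<rho> = mat dE dE (\<lambda>(e, e'). \<Sum>a<dA. \<rho> $$ (a * dE + e, a * dE + e'))"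

definition msum :: "nat \<Rightarrow> ('b \<Rightarrow> complex mat) \<Rightarrow> 'b set \<Rightarrow> complex mat" where
  "msum d f S = mat d d (\<lambda>ij. \<Sum>s\<in>S. f s $$ ij)"

definition proj :: "nat \<Rightarrow> nat \<Rightarrow> complex mat" where
  "proj d i = mat d d (\<lambda>(a, b). if a = i \<and> b = i then 1 else 0)"

text \<open>H_min(A|E) of a state phi on H_A (x) H_E, dim H_A = dA, dim H_E = dE:
  sup over density operators sigma_E of -log2 min{mu. mu 1_A (x) sigma_E - phi >= 0}
  (sigma_E for which no such mu exists contribute -infinity and are omitted).\<close>
definition hmin :: "nat \<Rightarrow> nat \<Rightarrow> complex mat \<Rightarrow> real" where
  "hmin dA dE \<phi> = Sup ((\<lambda>\<sigma>. - log 2 (Inf {\<mu>::real. psd (dA * dE) (\<mu> \<cdot>\<^sub>m kron (1\<^sub>m dA) \<sigma> - \<phi>)}))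
      ` {\<sigma>. density dE \<sigma> \<and> (\<exists>\<mu>::real. psd (dA * dE) (\<mu> \<cdot>\<^sub>m kron (1\<^sub>m dA) \<sigma> - \<phi>))})"

definition povm :: "nat \<Rightarrow> (nat \<Rightarrow> complex mat) \<Rightarrow> bool" where
  "povm D M \<longleftrightarrow> (\<forall>y. psd D (M y)) \<and>
     (\<forall>a<D. \<forall>b<D. (\<lambda>y. M y $$ (a, b)) sums (1\<^sub>m D $$ (a, b)))"

definition decomposition :: "nat \<Rightarrow> complex mat \<Rightarrow> (nat \<Rightarrow> real) \<Rightarrow> (nat \<Rightarrow> complex mat) \<Rightarrow> bool" where
  "decomposition d \<phi> p \<sigma> \<longleftrightarrow> (\<forall>i. 0 \<le> p i) \<and> p sums 1 \<and> (\<forall>i. density d (\<sigma> i)) \<and>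
     (\<forall>a<d. \<forall>b<d. (\<lambda>i. complex_of_real (p i) * \<sigma> i $$ (a, b)) sums (\<phi> $$ (a, b)))"

text \<open>R dE rho: the encryption channel acting on H_A (x) H_E (identity on E), dim H_A = dA.
  Its output is an operator on H_C (x) H_A (x) H_E with H_C a classical register.
  Strong (t,eps)-entropic security.  Pr[Adv(rho_i) = f(i)] = sum_i p_i Tr(M_{f i} rho_i).\<close>
definition strongly_ent_secure ::
    "nat \<Rightarrow> (nat \<Rightarrow> complex mat \<Rightarrow> complex mat) \<Rightarrow> real \<Rightarrow> real \<Rightarrow> bool" where
  "strongly_ent_secure dA R t \<epsilon> \<longleftrightarrow>
     (\<forall>dE \<phi> p \<sigma> (f :: nat \<Rightarrow> nat) M.
        dE \<ge> 1 \<and> density (dA * dE) \<phi> \<and> hmin dA dE \<phi> \<ge> t \<and> decomposition (dA * dE) \<phi> p \<sigma>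
        \<and> povm (dim_row (R dE \<phi>)) M \<longrightarrow>
        \<bar>(\<Sum>i. p i * Re (mtrace (M (f i) * R dE (\<sigma> i))))
          - (\<Sum>i. p i * Re (mtrace (M (f i) * kron (R 1 (ptrace_E dA dE \<phi>)) (ptrace_A dA dE (\<sigma> i)))))\<bar>
        \<le> \<epsilon>)"

definition Xmat :: "complex mat" where "Xmat = mat_of_rows_list 2 [[0, 1], [1, 0]]"
definition Zmat :: "complex mat" where "Zmat = mat_of_rows_list 2 [[1, 0], [0, -1]]"

definition pauli1 :: "bool \<Rightarrow> bool \<Rightarrow> complex mat" where
  "pauli1 s q = (if s then Xmat else 1\<^sub>m 2) * (if q then Zmat else 1\<^sub>m 2)"

text \<open>U_beta for beta = s || q of length 2n; qubit 1 is the leftmost tensor factor.\<close>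
definition Upauli :: "nat \<Rightarrow> bool list \<Rightarrow> complex mat" where
  "Upauli n \<beta> = foldr (\<lambda>i A. kron (pauli1 (\<beta> ! i) (\<beta> ! (n + i))) A) [0..<n] (1\<^sub>m 1)"

definition Fop :: "nat \<Rightarrow> nat \<Rightarrow> bool list \<Rightarrow> complex mat \<Rightarrow> complex mat" where
  "Fop n dE \<beta> \<rho> = (let W = kron (Upauli n \<beta>) (1\<^sub>m dE) in W * \<rho> * adj W)"

definition bitstrings :: "nat \<Rightarrow> bool list set" where
  "bitstrings m = {w. length w = m}"

definition poly_of_bits :: "bool list \<Rightarrow> bit poly" where
  "poly_of_bits w = (\<Sum>j<length w. monom (of_bool (w ! j)) (length w - 1 - j))"

definition bits_of_poly :: "nat \<Rightarrow> bit poly \<Rightarrow> bool list" where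
  "bits_of_poly m p = map (\<lambda>j. coeff p (m - 1 - j) \<noteq> 0) [0..<m]"

text \<open>Product in GF(2^lambda) = GF(2)[x]/(P), with degree P = lambda, as a lambda-bit string.\<close>
definition gf_mult :: "bit poly \<Rightarrow> bool list \<Rightarrow> bool list \<Rightarrow> bool list" where
  "gf_mult P a b = bits_of_poly (degree P) ((poly_of_bits a * poly_of_bits b) mod P)"

definition lsb :: "nat \<Rightarrow> bool list \<Rightarrow> bool list" where
  "lsb m w = drop (length w - m) w"

definition xor_bits :: "bool list \<Rightarrow> bool list \<Rightarrow> bool list" where
  "xor_bits a b = map2 (\<noteq>) a b"

definition bkey :: "nat \<Rightarrow> nat \<Rightarrow> bit poly \<Rightarrow> bool list \<Rightarrow> bool list \<Rightarrow> bool list \<Rightarrow> bool list" where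
  "bkey n l P k u v = k @ xor_bits (lsb (2 * n - l) (gf_mult P u k)) v"

text \<open>Big-endian value of a bit string (index of the classical basis state |w>).\<close>
definition nat_of_bits :: "bool list \<Rightarrow> nat" where
  "nat_of_bits w = foldl (\<lambda>a b. 2 * a + of_bool b) 0 w"

text \<open>The channel R of the scheme (key unknown), acting on H_A (x) H_E with dim H_E = dE:
  R(phi) = E_{u,v} |uv><uv| (x) 2^-l sum_k F_{b(k,u,v)}(phi), lambda = degree P.\<close>
definition Rchan :: "nat \<Rightarrow> nat \<Rightarrow> bit poly \<Rightarrow> nat \<Rightarrow> complex mat \<Rightarrow> complex mat" where
  "Rchan n l P dE \<phi> =
     (let lam = degree P; m = 2 * n - l; Dc = 2 ^ lam * 2 ^ m; dQ = 2 ^ n * dE in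
      msum (Dc * dQ)
        (\<lambda>(u, v). (1 / of_nat Dc) \<cdot>\<^sub>m
           kron (proj Dc (nat_of_bits (u @ v)))
                ((1 / 2 ^ l) \<cdot>\<^sub>m msum dQ (\<lambda>k. Fop n dE (bkey n l P k u v) \<phi>) (bitstrings l)))
        (bitstrings lam \<times> bitstrings m))"

end

theory Submission
  imports Defs "HOL-Computational_Algebra.Polynomial_Factorial"
begin

text \<open>
  Write \<open>R\<^sub>w\<close> for the encryption with public string \<open>w = (u, v)\<close> averaged over the key, and \<open>T\<close> for the
  average over all Pauli conjugations; \<open>T\<close> maps \<open>X\<close> to \<open>1/2^n \<otimes> Tr\<^sub>A X\<close> and \<open>R\<^sub>w T = T\<close>.
  Since the two states the adversary has to tell apart have the same image under \<open>T\<close>, only the centred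
  parts \<open>R\<^sub>w (1 - T)\<close> matter. Moving them to the measurement, both probabilities become, up to a common
  term, a sum of \<open>p\<^sub>i Tr (N\<^sub>y \<rho>\<^sub>i)\<close> with \<open>y = f i\<close>, where \<open>N\<^sub>y\<close> is the average over \<open>w\<close> of
  \<open>R\<^sub>w (1 - T) M\<^sub>y\<^sub>,\<^sub>w\<close>. By Cauchy-Schwarz and \<open>\<rho> \<le> \<mu> 1 \<otimes> \<sigma>\<close> it suffices to bound
  the sum over \<open>y\<close> of \<open>Tr (N\<^sub>y (1 \<otimes> \<sigma>) N\<^sub>y\<^sup>\<dagger>)\<close>. In the semi-inner product
  \<open>Tr (X (1 \<otimes> \<sigma>) Y\<^sup>\<dagger>)\<close> all Pauli conjugations are self-adjoint and compose by XOR of their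
  indices, and because \<open>b(k,u,v) + b(k',u,v)\<close> is uniform in its second part for \<open>k \<noteq> k'\<close>, the average
  of \<open>R\<^sub>w (1 - T) R\<^sub>w\<close> is at most \<open>2^-l\<close>. This gives the bound \<open>\<mu> 2^(n-l)\<close>.
\<close>

subsection \<open>Adjoint, trace, Kronecker product and sums of matrices\<close>

text \<open>The function \<open>f\<close> is arbitrary and may take infinitely many values, so no
  estimate may depend on the number of indices or outcomes. Indices with equal value
  \<open>y\<close> are collected: their weighted states sum to at most \<rho>, while the effects
  over all \<open>y\<close> sum to 1, so a squared estimate survives the sum over \<open>y\<close>.
  The ideal case fits the same scheme because R(\<phi>^A) \<otimes> \<sigma>_i^E is the encryption
  of a product state. These product states decompose \<phi>^A \<otimes> \<phi>^E, and tracing E out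
  of \<phi> \<le> \<mu> 1 \<otimes> \<sigma> gives \<phi>^A \<otimes> \<phi>^E \<le> \<mu> 1
  \<otimes> \<phi>^E with the same \<mu>. The weight stands on one side of the semi-inner product,
  so neither a root nor an inverse of a possibly singular \<sigma> occurs. The 3 in the key length
  is 1 for approximating the supremum in the min-entropy plus 2 because each of the two
  probabilities may deviate from the common term by \<open>\<epsilon> / 2\<close>, and \<mu> 2^(n-l)
  has to stay below the square of that.\<close>

lemma sum_lessThan_mult:
  fixes f :: "nat \<Rightarrow> 'a::comm_monoid_add"
  shows "(\<Sum>i<a * b. f i) = (\<Sum>x<a. \<Sum>y<b. f (x * b + y))"
proof -
  have "sum f {m * b..<m * b + b} = (\<Sum>y<b. f (m * b + y))" for m
    using sum.shift_bounds_nat_ivl[of f 0 "m * b" b]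
    by (simp add: atLeast0LessThan add.commute)
  then show ?thesis
    using sum.nat_group[of f b a] by simp
qed

lemma mult_add_less_mult:
  fixes x y a b :: nat
  assumes "x < a" "y < b"
  shows "x * b + y < a * b"
proof -
  have "x * b + y < Suc x * b" using assms by simp
  also have "\<dots> \<le> a * b" using assms by (intro mult_le_mono1) simp
  finally show ?thesis .
qed

lemma index_mult_mat_sum:
  assumes "A \<in> carrier_mat a b" "B \<in> carrier_mat b c" "i < a" "j < c"
  shows "(A * B) $$ (i, j) = (\<Sum>k<b. A $$ (i, k) * B $$ (k, j))"
  using assms by (auto simp: scalar_prod_def atLeast0LessThan intro!: sum.cong)

lemma adj_carrier [simp]: "A \<in> carrier_mat a b \<Longrightarrow> adj A \<in> carrier_mat b a"
  by (simp add: adj_def)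

lemma dim_adj [simp]: "dim_row (adj A) = dim_col A" "dim_col (adj A) = dim_row A"
  by (simp_all add: adj_def)

lemma index_adj [simp]: "i < dim_col A \<Longrightarrow> j < dim_row A \<Longrightarrow> adj A $$ (i, j) = cnj (A $$ (j, i))"
  by (simp add: adj_def)

lemma adj_adj [simp]: "adj (adj A) = A"
  by (rule eq_matI) auto

lemma adj_one [simp]: "adj (1\<^sub>m d) = 1\<^sub>m d"
  by (rule eq_matI) auto

lemma adj_smult: "adj (c \<cdot>\<^sub>m A) = cnj c \<cdot>\<^sub>m adj A"
  by (rule eq_matI) auto

lemma adj_mult:
  assumes "A \<in> carrier_mat a b" "B \<in> carrier_mat b c"
  shows "adj (A * B) = adj B * adj A"
proof (rule eq_matI)
  fix i j assume "i < dim_row (adj B * adj A)" "j < dim_col (adj B * adj A)"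
  then have ij: "i < c" "j < a" using assms by auto
  show "adj (A * B) $$ (i, j) = (adj B * adj A) $$ (i, j)"
    using assms ij
    by (subst index_mult_mat_sum[of _ c b _ a])
       (auto simp: index_mult_mat_sum[OF assms] scalar_prod_def atLeast0LessThan mult.commute intro!: sum.cong)
qed (use assms in auto)

lemma adj_minus:
  assumes "A \<in> carrier_mat a b" "B \<in> carrier_mat a b"
  shows "adj (A - B) = adj A - adj B"
  using assms by (intro eq_matI) auto

lemma mtrace_mult:
  assumes "A \<in> carrier_mat a b" "B \<in> carrier_mat b a"
  shows "mtrace (A * B) = (\<Sum>i<a. \<Sum>j<b. A $$ (i, j) * B $$ (j, i))"
  using assms by (auto simp: mtrace_def index_mult_mat_sum[OF assms] intro!: sum.cong simp del: index_mult_mat(1))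

lemma mtrace_comm:
  assumes "A \<in> carrier_mat a b" "B \<in> carrier_mat b a"
  shows "mtrace (A * B) = mtrace (B * A)"
  unfolding mtrace_mult[OF assms] mtrace_mult[OF assms(2,1)]
  by (subst sum.swap) (simp add: mult.commute)

lemma mtrace_smult: "A \<in> carrier_mat d d \<Longrightarrow> mtrace (c \<cdot>\<^sub>m A) = c * mtrace A"
  by (auto simp: mtrace_def sum_distrib_left)

lemma mtrace_minus:
  "A \<in> carrier_mat d d \<Longrightarrow> B \<in> carrier_mat d d \<Longrightarrow> mtrace (A - B) = mtrace A - mtrace B"
  by (auto simp: mtrace_def sum_subtractf)

lemma mtrace_adj: "A \<in> carrier_mat d d \<Longrightarrow> mtrace (adj A) = cnj (mtrace A)"
  by (auto simp: mtrace_def)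

lemma mtrace_one: "mtrace (1\<^sub>m d) = of_nat d"
  by (simp add: mtrace_def)

section \<open>Finite sums of matrices\<close>

lemma msum_carrier [simp]: "msum d f S \<in> carrier_mat d d"
  by (simp add: msum_def)

lemma dim_msum [simp]: "dim_row (msum d f S) = d" "dim_col (msum d f S) = d"
  by (simp_all add: msum_def)

lemma index_msum [simp]: "i < d \<Longrightarrow> j < d \<Longrightarrow> msum d f S $$ (i, j) = (\<Sum>s\<in>S. f s $$ (i, j))"
  by (simp add: msum_def)

lemma msum_cong: "(\<And>s. s \<in> S \<Longrightarrow> f s = g s) \<Longrightarrow> msum d f S = msum d g S"
  by (simp add: msum_def)

lemma msum_reindex_bij_betw: "bij_betw h S T \<Longrightarrow> msum d (\<lambda>x. f (h x)) S = msum d f T"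
  unfolding msum_def by (intro eq_matI) (auto intro: sum.reindex_bij_betw)

lemma msum_mult_left:
  assumes "A \<in> carrier_mat d d" "\<And>s. s \<in> S \<Longrightarrow> f s \<in> carrier_mat d d"
  shows "A * msum d f S = msum d (\<lambda>s. A * f s) S"
proof (rule eq_matI)
  fix i j assume "i < dim_row (msum d (\<lambda>s. A * f s) S)" "j < dim_col (msum d (\<lambda>s. A * f s) S)"
  then have ij: "i < d" "j < d" by auto
  have "(A * msum d f S) $$ (i, j) = (\<Sum>k<d. A $$ (i, k) * (\<Sum>s\<in>S. f s $$ (k, j)))"
    using assms ij by (simp add: index_mult_mat_sum[of _ d d _ d] del: index_mult_mat(1))
  also have "\<dots> = (\<Sum>s\<in>S. \<Sum>k<d. A $$ (i, k) * f s $$ (k, j))"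
    by (simp add: sum_distrib_left) (rule sum.swap)
  also have "\<dots> = msum d (\<lambda>s. A * f s) S $$ (i, j)"
    using assms ij by (simp add: index_mult_mat_sum[of _ d d _ d] del: index_mult_mat(1))
  finally show "(A * msum d f S) $$ (i, j) = msum d (\<lambda>s. A * f s) S $$ (i, j)" .
qed (use assms in auto)

lemma adj_msum:
  assumes "\<And>s. s \<in> S \<Longrightarrow> f s \<in> carrier_mat d d"
  shows "adj (msum d f S) = msum d (\<lambda>s. adj (f s)) S"
proof (rule eq_matI)
  fix i j assume "i < dim_row (msum d (\<lambda>s. adj (f s)) S)" "j < dim_col (msum d (\<lambda>s. adj (f s)) S)"
  then have ij: "i < d" "j < d" by auto
  have "s \<in> S \<Longrightarrow> dim_row (f s) = d \<and> dim_col (f s) = d" for s using assms by auto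
  then show "adj (msum d f S) $$ (i, j) = msum d (\<lambda>s. adj (f s)) S $$ (i, j)"
    using ij by simp
qed auto

lemma msum_mult_right:
  assumes "A \<in> carrier_mat d d" "\<And>s. s \<in> S \<Longrightarrow> f s \<in> carrier_mat d d"
  shows "msum d f S * A = msum d (\<lambda>s. f s * A) S"
proof -
  have "msum d f S * A = adj (adj A * msum d (\<lambda>s. adj (f s)) S)"
    using assms by (subst adj_mult[of _ d d _ d]) (auto simp: adj_msum)
  also have "\<dots> = adj (msum d (\<lambda>s. adj A * adj (f s)) S)"
    using assms by (subst msum_mult_left) auto
  also have "\<dots> = msum d (\<lambda>s. f s * A) S"
    using assms by (subst adj_msum) (auto intro!: msum_cong mult_carrier_mat[of _ d d] simp: adj_mult[of _ d d _ d])
  finally show ?thesis .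
qed

lemma mtrace_msum:
  assumes "\<And>s. s \<in> S \<Longrightarrow> f s \<in> carrier_mat d d"
  shows "mtrace (msum d f S) = (\<Sum>s\<in>S. mtrace (f s))"
proof -
  have "mtrace (msum d f S) = (\<Sum>i<d. \<Sum>s\<in>S. f s $$ (i, i))" by (simp add: mtrace_def)
  also have "\<dots> = (\<Sum>s\<in>S. \<Sum>i<d. f s $$ (i, i))" by (rule sum.swap)
  also have "\<dots> = (\<Sum>s\<in>S. mtrace (f s))"
    using assms by (intro sum.cong refl) (auto simp: mtrace_def)
  finally show ?thesis .
qed

lemma msum_const: "A \<in> carrier_mat d d \<Longrightarrow> msum d (\<lambda>_. A) S = of_nat (card S) \<cdot>\<^sub>m A"
  by (intro eq_matI) auto

section \<open>Kronecker products in block coordinates\<close>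

lemma kron_carrier [simp]:
  "A \<in> carrier_mat a b \<Longrightarrow> B \<in> carrier_mat c d \<Longrightarrow> kron A B \<in> carrier_mat (a * c) (b * d)"
  by (simp add: kron_def)

lemma dim_kron [simp]:
  "dim_row (kron A B) = dim_row A * dim_row B" "dim_col (kron A B) = dim_col A * dim_col B"
  by (simp_all add: kron_def)

lemma index_kron:
  assumes "A \<in> carrier_mat a b" "B \<in> carrier_mat c d" "i < a" "j < b" "x < c" "y < d"
  shows "kron A B $$ (i * c + x, j * d + y) = A $$ (i, j) * B $$ (x, y)"
  using assms mult_add_less_mult[of i a x c] mult_add_less_mult[of j b y d]
  by (auto simp: kron_def)

lemma less_multE:
  fixes i a c :: nat
  assumes "i < a * c"
  obtains x y where "x < a" "y < c" "i = x * c + y"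
proof -
  have "c > 0" using assms by (cases c) auto
  then show ?thesis
    using that[of "i div c" "i mod c"] assms by (simp add: less_mult_imp_div_less)
qed

text \<open>Comparing entries at \<open>i * c + x\<close> keeps the \<open>div\<close> and
  \<open>mod\<close> of \<open>kron\<close> out of all later index computations.\<close>

lemma eq_mat_kronI:
  assumes "A \<in> carrier_mat (a * c) (b * d)" "B \<in> carrier_mat (a * c) (b * d)"
    and "\<And>i j x y. i < a \<Longrightarrow> j < b \<Longrightarrow> x < c \<Longrightarrow> y < d \<Longrightarrow>
           A $$ (i * c + x, j * d + y) = B $$ (i * c + x, j * d + y)"
  shows "A = B"
proof (rule eq_matI)
  fix i j assume "i < dim_row B" "j < dim_col B"
  then have "i < a * c" "j < b * d" using assms by auto
  then show "A $$ (i, j) = B $$ (i, j)" by (elim less_multE) (simp add: assms(3))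
qed (use assms in auto)

lemma kron_mult:
  assumes "A \<in> carrier_mat a b" "B \<in> carrier_mat c d" "A' \<in> carrier_mat b e" "B' \<in> carrier_mat d f"
  shows "kron A B * kron A' B' = kron (A * A') (B * B')"
proof (rule eq_mat_kronI)
  fix i j x y assume *: "i < a" "j < e" "x < c" "y < f"
  have "(kron A B * kron A' B') $$ (i * c + x, j * f + y) =
    (\<Sum>k<b. \<Sum>z<d. A $$ (i, k) * B $$ (x, z) * (A' $$ (k, j) * B' $$ (z, y)))"
    using * assms mult_add_less_mult[of i a x c] mult_add_less_mult[of j e y f]
    by (subst index_mult_mat_sum[of _ "a * c" "b * d" _ "e * f"])
       (auto simp: sum_lessThan_mult index_kron[OF assms(1,2)] index_kron[OF assms(3,4)] intro!: sum.cong)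
  also have "\<dots> = (\<Sum>k<b. A $$ (i, k) * A' $$ (k, j)) * (\<Sum>z<d. B $$ (x, z) * B' $$ (z, y))"
    by (simp add: sum_product mult_ac)
  also have "\<dots> = kron (A * A') (B * B') $$ (i * c + x, j * f + y)"
    using * assms
    by (subst index_kron[of _ a e _ c f])
       (auto simp: index_mult_mat_sum[OF assms(1,3)] index_mult_mat_sum[OF assms(2,4)]
             simp del: index_mult_mat(1))
  finally show "(kron A B * kron A' B') $$ (i * c + x, j * f + y) = 
      kron (A * A') (B * B') $$ (i * c + x, j * f + y)" .
qed (use assms in \<open>auto intro!: mult_carrier_mat kron_carrier\<close>)

lemma adj_kron:
  assumes "A \<in> carrier_mat a b" "B \<in> carrier_mat c d"
  shows "adj (kron A B) = kron (adj A) (adj B)"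
proof (rule eq_mat_kronI)
  fix i j x y assume "i < b" "j < a" "x < d" "y < c"
  then show "adj (kron A B) $$ (i * d + x, j * c + y) = kron (adj A) (adj B) $$ (i * d + x, j * c + y)"
    using assms mult_add_less_mult[of i b x d] mult_add_less_mult[of j a y c]
    by (simp add: index_kron[of _ b a _ d c] index_kron[OF assms])
qed (use assms in auto)

lemma kron_smult_left: "kron (c \<cdot>\<^sub>m A) B = c \<cdot>\<^sub>m kron A B"
  by (rule eq_matI) (auto simp: kron_def less_mult_imp_div_less)

lemma kron_smult_right: "kron A (c \<cdot>\<^sub>m B) = c \<cdot>\<^sub>m kron A B"
proof (rule eq_matI)
  fix i j assume "i < dim_row (c \<cdot>\<^sub>m kron A B)" "j < dim_col (c \<cdot>\<^sub>m kron A B)"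
  then have *: "i < dim_row A * dim_row B" "j < dim_col A * dim_col B" by auto
  then have "dim_row B > 0" "dim_col B > 0" by (metis mult_0_right not_gr_zero not_less_zero)+
  then show "kron A (c \<cdot>\<^sub>m B) $$ (i, j) = (c \<cdot>\<^sub>m kron A B) $$ (i, j)"
    using * by (simp add: kron_def)
qed auto

lemma kron_minus_left:
  assumes "A \<in> carrier_mat a b" "A' \<in> carrier_mat a b" "B \<in> carrier_mat c d"
  shows "kron (A - A') B = kron A B - kron A' B"
proof (rule eq_mat_kronI)
  fix i j x y assume "i < a" "j < b" "x < c" "y < d"
  then show "kron (A - A') B $$ (i * c + x, j * d + y) = (kron A B - kron A' B) $$ (i * c + x, j * d + y)"
    using assms mult_add_less_mult[of i a x c] mult_add_less_mult[of j b y d]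
    by (auto simp: index_kron[of _ a b _ c d] left_diff_distrib minus_carrier_mat)
qed (use assms in auto)

lemma kron_one: "kron (1\<^sub>m a) (1\<^sub>m b) = 1\<^sub>m (a * b)"
proof (rule eq_mat_kronI)
  fix i j x y assume *: "i < a" "j < a" "x < b" "y < b"
  then have "i * b + x = j * b + y \<longleftrightarrow> i = j \<and> x = y"
    by (metis add.commute add_cancel_left_left div_less div_mult_self1 less_nat_zero_code mod_less mod_mult_self3)
  then show "kron (1\<^sub>m a) (1\<^sub>m b) $$ (i * b + x, j * b + y) = 1\<^sub>m (a * b) $$ (i * b + x, j * b + y)"
    using * mult_add_less_mult[of i a x b] mult_add_less_mult[of j a y b]
    by (simp add: index_kron[of _ a a _ b b])
qed auto

lemma kron_one_1_right: "kron A (1\<^sub>m 1) = A"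
  by (rule eq_matI) (auto simp: kron_def)

lemma kron_assoc: "kron (kron A B) C = kron A (kron B C)"
proof -
  obtain a b where A: "A \<in> carrier_mat a b" by blast
  obtain c d where B: "B \<in> carrier_mat c d" by blast
  obtain e f where C: "C \<in> carrier_mat e f" by blast
  show ?thesis
  proof (rule eq_mat_kronI[of _ a "c * e" b "d * f"])
    fix i j x y assume ij: "i < a" "j < b" and "x < c * e" "y < d * f"
    then obtain x1 x2 y1 y2 where xy: "x1 < c" "x2 < e" "x = x1 * e + x2" "y1 < d" "y2 < f" "y = y1 * f + y2"
      by (elim less_multE) blast
    have "kron (kron A B) C $$ ((i * c + x1) * e + x2, (j * d + y1) * f + y2) = A $$ (i, j) * B $$ (x1, y1) * C $$ (x2, y2)"
      using A B C ij xy mult_add_less_mult[of i a x1 c] mult_add_less_mult[of j b y1 d]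
      by (simp add: index_kron[of _ "a * c" "b * d" _ e f] index_kron[of _ a b _ c d])
    moreover have "kron A (kron B C) $$ (i * (c * e) + x, j * (d * f) + y) = A $$ (i, j) * B $$ (x1, y1) * C $$ (x2, y2)"
      using A B C ij xy mult_add_less_mult[of x1 c x2 e] mult_add_less_mult[of y1 d y2 f]
      by (simp add: index_kron[of _ a b _ "c * e" "d * f"] index_kron[of _ c d _ e f])
    ultimately show "kron (kron A B) C $$ (i * (c * e) + x, j * (d * f) + y) =
        kron A (kron B C) $$ (i * (c * e) + x, j * (d * f) + y)"
      using xy by (simp add: algebra_simps)
  qed (use A B C in \<open>auto simp: algebra_simps\<close>)
qed

lemma kron_msum_left:
  assumes "\<And>s. s \<in> S \<Longrightarrow> f s \<in> carrier_mat a a" "B \<in> carrier_mat c c"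
  shows "kron (msum a f S) B = msum (a * c) (\<lambda>s. kron (f s) B) S"
proof (rule eq_mat_kronI[of _ a c a c])
  fix i j x y assume "i < a" "j < a" "x < c" "y < c"
  then show "kron (msum a f S) B $$ (i * c + x, j * c + y) = msum (a * c) (\<lambda>s. kron (f s) B) S $$ (i * c + x, j * c + y)"
    using assms mult_add_less_mult[of i a x c] mult_add_less_mult[of j a y c]
    by (simp add: index_kron[of _ a a _ c c] sum_distrib_right)
qed (use assms in auto)

lemma mtrace_kron:
  assumes "A \<in> carrier_mat a a" "B \<in> carrier_mat c c"
  shows "mtrace (kron A B) = mtrace A * mtrace B"
  using assms by (simp add: mtrace_def sum_lessThan_mult index_kron[OF assms] sum_product)

subsection \<open>Positive semidefinite matrices\<close>

text \<open>Takes a coefficient function instead of a matrix, so that Schur complements can be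
  formed entry by entry without carrier conditions.\<close>

definition qform :: "nat \<Rightarrow> (nat \<Rightarrow> nat \<Rightarrow> complex) \<Rightarrow> (nat \<Rightarrow> complex) \<Rightarrow> complex" where
  "qform d A v = (\<Sum>a<d. \<Sum>b<d. cnj (v a) * A a b * v b)"

lemma psd_iff_qform:
  "psd d A \<longleftrightarrow> A \<in> carrier_mat d d \<and>
     (\<forall>v. Im (qform d (\<lambda>a b. A $$ (a, b)) v) = 0 \<and> 0 \<le> Re (qform d (\<lambda>a b. A $$ (a, b)) v))"
  by (simp add: psd_def qform_def)

lemma qform_single:
  assumes "i < d"
  shows "qform d A (\<lambda>a. if a = i then z else 0) = cnj z * A i i * z"
  using assms unfolding qform_def
  by (simp add: if_distrib[of cnj] if_distrib[of "\<lambda>x. x * _"] if_distrib[of "\<lambda>x. _ * x"] sum.delta cong: if_cong)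

lemma qform_plus:
  "qform d A (\<lambda>a. v a + w a) = qform d A v + qform d A w
     + (\<Sum>a<d. \<Sum>b<d. cnj (v a) * A a b * w b) + (\<Sum>a<d. \<Sum>b<d. cnj (w a) * A a b * v b)"
  unfolding qform_def by (simp add: algebra_simps sum.distrib)

lemma qform_pair:
  assumes "i < d" "j < d" "i \<noteq> j"
  shows "qform d A (\<lambda>a. (if a = i then x else 0) + (if a = j then y else 0)) =
    cnj x * A i i * x + cnj y * A j j * y + cnj x * A i j * y + cnj y * A j i * x"
  unfolding qform_plus qform_single[OF assms(1)] qform_single[OF assms(2)]
  using assms
  by (simp add: if_distrib[of cnj] if_distrib[of "\<lambda>x. x * _"] if_distrib[of "\<lambda>x. _ * x"] sum.delta cong: if_cong)

definition psdf :: "nat \<Rightarrow> (nat \<Rightarrow> nat \<Rightarrow> complex) \<Rightarrow> bool" where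
  "psdf d A \<longleftrightarrow> (\<forall>v. Im (qform d A v) = 0 \<and> 0 \<le> Re (qform d A v))"

lemma psdf_diag:
  assumes "psdf d A" "i < d"
  shows "Im (A i i) = 0" "0 \<le> Re (A i i)"
  using assms(1)[unfolded psdf_def, rule_format, of "\<lambda>a. if a = i then 1 else 0"]
  by (simp_all add: qform_single[OF assms(2)])

text \<open>Hermiticity has to be derived from the realness of the form: the vector e_i + e_j
  settles the imaginary parts of the two entries, e_i + \<i> e_j the real parts.\<close>

lemma psdf_hermitian:
  assumes "psdf d A" "i < d" "j < d"
  shows "A j i = cnj (A i j)"
proof (cases "i = j")
  case True
  then show ?thesis using psdf_diag[OF assms(1,2)] by (simp add: complex_eq_iff)
next
  case False
  note p = qform_pair[OF assms(2,3) False, of A]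
  have q: "Im (qform d A v) = 0" for v using assms(1) by (simp add: psdf_def)
  have "Im (A i j) + Im (A j i) = 0"
    using q[of "\<lambda>a. (if a = i then 1 else 0) + (if a = j then 1 else 0)"]
      psdf_diag[OF assms(1,2)] psdf_diag[OF assms(1,3)] unfolding p by simp
  moreover have "Re (A i j) - Re (A j i) = 0"
    using q[of "\<lambda>a. (if a = i then 1 else 0) + (if a = j then \<i> else 0)"]
      psdf_diag[OF assms(1,2)] psdf_diag[OF assms(1,3)] unfolding p by simp
  ultimately show ?thesis by (simp add: complex_eq_iff)
qed

lemma psdf_zero_diag:
  assumes "psdf d A" "i < d" "j < d" "A i i = 0"
  shows "A j i = 0"
proof (rule ccontr)
  assume nz: "A j i \<noteq> 0"
  then have ne: "i \<noteq> j" using assms(4) by auto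
  \<comment> \<open>With this \<open>c\<close> the form at c e_i + e_j has real part -1.\<close>
  define c where "c = - of_real (Re (A j j) + 1) / (2 * A j i)"
  have h: "A i j = cnj (A j i)" using psdf_hermitian[OF assms(1,3,2)] .
  have "0 \<le> Re (qform d A (\<lambda>a. (if a = i then c else 0) + (if a = j then 1 else 0)))"
    using assms(1) unfolding psdf_def by blast
  also have "\<dots> = Re (A j j) + Re (cnj (A j i * c)) + Re (A j i * c)"
    unfolding qform_pair[OF assms(2,3) ne] by (simp add: assms(4) h mult.commute)
  also have "A j i * c = - of_real (Re (A j j) + 1) / 2" using nz by (simp add: c_def)
  finally show False by simp
qed

text \<open>Completing the square: the new form at \<open>v\<close> is the old form at v + t e_k,
  where \<open>t\<close> is chosen so that coordinate \<open>k\<close> of A (v + t e_k)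
  vanishes.\<close>

lemma psdf_schur_complement:
  assumes "psdf d A" "k < d" "A k k \<noteq> 0"
  shows "psdf d (\<lambda>a b. A a b - A a k * A k b / A k k)"
  unfolding psdf_def
proof (intro allI)
  fix v
  define s where "s = (\<Sum>b<d. A k b * v b)"
  define t where "t = - s / A k k"
  have Akk: "cnj (A k k) = A k k" using psdf_diag[OF assms(1,2)] by (simp add: complex_eq_iff)
  have herm: "A a k = cnj (A k a)" if "a < d" for a using psdf_hermitian[OF assms(1,2) that] .
  have cs: "(\<Sum>a<d. cnj (v a) * A a k) = cnj s"
    unfolding s_def by (auto simp: herm mult.commute intro!: sum.cong)
  have d1: "(\<Sum>a<d. \<Sum>b<d. cnj (v a) * A a b * (if b = k then t else 0)) = cnj s * t"
    using assms(2) by (simp add: if_distrib[of "\<lambda>x. _ * x"] sum.delta cs flip: sum_distrib_right cong: if_cong)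
  have d2: "(\<Sum>a<d. \<Sum>b<d. cnj (if a = k then t else 0) * A a b * v b) = cnj t * s"
    using assms(2) unfolding s_def
    by (subst sum.swap) (simp add: if_distrib[of cnj] if_distrib[of "\<lambda>x. x * _"] sum.delta sum_distrib_left mult.assoc cong: if_cong)
  have "(\<Sum>a<d. \<Sum>b<d. cnj (v a) * (A a k * A k b / A k k) * v b)
      = (\<Sum>a<d. cnj (v a) * A a k) * (\<Sum>b<d. A k b * v b) / A k k"
    unfolding sum_product sum_divide_distrib by (simp add: mult_ac)
  then have "qform d (\<lambda>a b. A a b - A a k * A k b / A k k) v = qform d A v - cnj s * s / A k k"
    unfolding qform_def cs s_def[symmetric] by (simp add: right_diff_distrib left_diff_distrib sum_subtractf)
  also have "\<dots> = qform d A (\<lambda>a. v a + (if a = k then t else 0))"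
    unfolding qform_plus qform_single[OF assms(2)] d1 d2 using assms(3) Akk
    by (simp add: t_def field_simps)
  finally show "Im (qform d (\<lambda>a b. A a b - A a k * A k b / A k k) v) = 0 \<and>
      0 \<le> Re (qform d (\<lambda>a b. A a b - A a k * A k b / A k k) v)"
    using assms(1) by (simp add: psdf_def)
qed

text \<open>Cholesky decomposition: eliminate the last nonzero row and column by a Schur complement.\<close>

lemma psdf_cholesky:
  assumes "psdf d A" "k \<le> d" "\<And>a b. a < d \<Longrightarrow> b < d \<Longrightarrow> k \<le> a \<or> k \<le> b \<Longrightarrow> A a b = 0"
  shows "\<exists>V. \<forall>a<d. \<forall>b<d. A a b = (\<Sum>j<k. V a j * cnj (V b j))"
  using assms
proof (induction k arbitrary: A)
  case (Suc k)
  then have k: "k < d" by simp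
  show ?case
  proof (cases "A k k = 0")
    case True
    have "A a k = 0 \<and> A k a = 0" if "a < d" for a
      using psdf_zero_diag[OF Suc.prems(1) k that True] psdf_hermitian[OF Suc.prems(1) that k] by simp
    then have "A a b = 0" if "a < d" "b < d" "k \<le> a \<or> k \<le> b" for a b
      using Suc.prems(3)[OF that(1,2)] that by (cases "a = k \<or> b = k") auto
    from Suc.IH[OF Suc.prems(1) _ this] k obtain V where
      V: "\<forall>a<d. \<forall>b<d. A a b = (\<Sum>j<k. V a j * cnj (V b j))" by auto
    \<comment> \<open>A zero pivot forces a zero row and column, so a zero column of
      \<open>V\<close> is enough.\<close>
    show ?thesis
      by (rule exI[of _ "\<lambda>a j. if j = k then 0 else V a j"]) (use V in auto)
  next
    case False
    define B where "B = (\<lambda>a b. A a b - A a k * A k b / A k k)"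
    have "psdf d B" unfolding B_def by (rule psdf_schur_complement[OF Suc.prems(1) k False])
    moreover have "B a b = 0" if "a < d" "b < d" "k \<le> a \<or> k \<le> b" for a b
    proof (cases "a = k \<or> b = k")
      case True
      then show ?thesis using False by (auto simp: B_def)
    next
      case False
      then have "Suc k \<le> a \<or> Suc k \<le> b" using that by auto
      then have "A a b = 0" "A a k * A k b = 0"
        using Suc.prems(3)[OF that(1,2)] Suc.prems(3)[OF that(1) k] Suc.prems(3)[OF k that(2)] by auto
      then show ?thesis by (simp add: B_def)
    qed
    ultimately obtain V where V: "\<forall>a<d. \<forall>b<d. B a b = (\<Sum>j<k. V a j * cnj (V b j))"
      using Suc.IH[of B] k by auto
    \<comment> \<open>\<open>r\<close> is the square root of the pivot; the column
      \<open>A a k / cnj r\<close> restores the rank-one term removed by the Schur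
      complement.\<close>
    define r where "r = complex_of_real (sqrt (Re (A k k)))"
    have rr: "r * cnj r = A k k"
      using psdf_diag[OF Suc.prems(1) k] by (simp add: r_def complex_eq_iff flip: of_real_mult)
    have "A a b = (\<Sum>j<Suc k. (if j = k then A a k / cnj r else V a j) * cnj (if j = k then A b k / cnj r else V b j))"
      if "a < d" "b < d" for a b
    proof -
      have "A a b = B a b + A a k * A k b / A k k" by (simp add: B_def)
      moreover have "A a k / cnj r * cnj (A b k / cnj r) = A a k * A k b / A k k"
        using psdf_hermitian[OF Suc.prems(1) that(2) k] by (simp add: rr[symmetric] mult.commute)
      ultimately show ?thesis using V that by simp
    qed
    then show ?thesis
      by (intro exI[of _ "\<lambda>a j. if j = k then A a k / cnj r else V a j"]) blast
  qed
qed simp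

lemma psd_carrier: "psd d A \<Longrightarrow> A \<in> carrier_mat d d"
  by (simp add: psd_def)

text \<open>Stands in for a positive square root: the factorisation is all that Hermiticity, tensor
  products and traces of products need, and no spectral theorem is involved.\<close>

lemma psd_cholesky:
  assumes "psd d A"
  obtains V where "V \<in> carrier_mat d d" "A = V * adj V"
proof -
  have c: "A \<in> carrier_mat d d" using assms by (rule psd_carrier)
  have "psdf d (\<lambda>a b. A $$ (a, b))" using assms by (simp add: psd_iff_qform psdf_def)
  then obtain V where V: "\<forall>a<d. \<forall>b<d. A $$ (a, b) = (\<Sum>j<d. V a j * cnj (V b j))"
    using psdf_cholesky[of d _ d] by force
  have "A = mat d d (\<lambda>(a, j). V a j) * adj (mat d d (\<lambda>(a, j). V a j))"
    using c V by (intro eq_matI) (auto simp: index_mult_mat_sum[of _ d d _ d] simp del: index_mult_mat(1))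
  then show ?thesis using that[of "mat d d (\<lambda>(a, j). V a j)"] by simp
qed

lemma psd_hermitian: "psd d A \<Longrightarrow> adj A = A"
  by (elim psd_cholesky) (simp add: adj_mult[of _ d d _ d])

lemma qform_conjugate:
  assumes "V \<in> carrier_mat d e" "A \<in> carrier_mat e e"
  shows "qform d (\<lambda>a b. (V * A * adj V) $$ (a, b)) v =
    qform e (\<lambda>a b. A $$ (a, b)) (\<lambda>j. \<Sum>b<d. cnj (V $$ (b, j)) * v b)"
proof -
  have VA: "V * A \<in> carrier_mat d e" using assms by simp
  have "(V * A * adj V) $$ (a, b) = (\<Sum>j<e. \<Sum>i<e. V $$ (a, i) * A $$ (i, j) * cnj (V $$ (b, j)))"
    if "a < d" "b < d" for a b
    using assms that VA
    by (simp add: index_mult_mat_sum[OF VA, of "adj V" d] index_mult_mat_sum[OF assms] sum_distrib_right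
        del: index_mult_mat(1))
  then have "qform d (\<lambda>a b. (V * A * adj V) $$ (a, b)) v =
    (\<Sum>a<d. \<Sum>b<d. \<Sum>j<e. \<Sum>i<e. cnj (v a) * (V $$ (a, i) * A $$ (i, j) * cnj (V $$ (b, j))) * v b)"
    unfolding qform_def by (simp add: sum_distrib_left sum_distrib_right)
  also have "\<dots> = (\<Sum>a<d. \<Sum>j<e. \<Sum>i<e. \<Sum>b<d. cnj (v a) * (V $$ (a, i) * A $$ (i, j) * cnj (V $$ (b, j))) * v b)"
    by (subst sum.swap[of _ "{..<e}" "{..<d}"], subst sum.swap[of _ "{..<e}" "{..<d}"]) simp
  also have "\<dots> = (\<Sum>j<e. \<Sum>i<e. \<Sum>a<d. \<Sum>b<d. cnj (v a) * (V $$ (a, i) * A $$ (i, j) * cnj (V $$ (b, j))) * v b)"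
    by (subst sum.swap[of _ "{..<e}" "{..<d}"], subst sum.swap[of _ "{..<e}" "{..<d}"]) simp
  also have "\<dots> = (\<Sum>i<e. \<Sum>j<e. \<Sum>a<d. \<Sum>b<d. cnj (v a) * (V $$ (a, i) * A $$ (i, j) * cnj (V $$ (b, j))) * v b)"
    by (rule sum.swap)
  also have "\<dots> = qform e (\<lambda>a b. A $$ (a, b)) (\<lambda>j. \<Sum>b<d. cnj (V $$ (b, j)) * v b)"
    unfolding qform_def by (simp add: sum_product sum_distrib_left sum_distrib_right mult_ac)
  finally show ?thesis .
qed

lemma psd_conjugate:
  assumes "V \<in> carrier_mat d e" "psd e A"
  shows "psd d (V * A * adj V)"
  using assms qform_conjugate[OF assms(1) psd_carrier[OF assms(2)]]
  by (auto simp: psd_iff_qform intro: mult_carrier_mat)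

lemma psd_one: "psd d (1\<^sub>m d)"
proof -
  have "qform d (\<lambda>a b. 1\<^sub>m d $$ (a, b)) v = of_real (\<Sum>a<d. (cmod (v a))\<^sup>2)" for v
    unfolding qform_def
    by (auto simp: if_distrib[of "\<lambda>x. x * _"] if_distrib[of "\<lambda>x. _ * x"] sum.delta mult.commute
        complex_norm_square[symmetric] cong: if_cong)
  then show ?thesis by (simp add: psd_iff_qform sum_nonneg)
qed

lemma psd_mult_adj: "V \<in> carrier_mat d e \<Longrightarrow> psd d (V * adj V)"
  using psd_conjugate[OF _ psd_one, of V d e] by simp

lemma psd_kron:
  assumes "psd a A" "psd b B"
  shows "psd (a * b) (kron A B)"
proof -
  obtain V where V: "V \<in> carrier_mat a a" "A = V * adj V" using assms(1) by (rule psd_cholesky)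
  obtain W where W: "W \<in> carrier_mat b b" "B = W * adj W" using assms(2) by (rule psd_cholesky)
  have "kron A B = kron V W * adj (kron V W)"
    using V W by (simp add: adj_kron[of _ a a _ b b] kron_mult[of _ a a _ b b _ a _ b])
  then show ?thesis using V W psd_mult_adj[of "kron V W" "a * b" "a * b"] by simp
qed

lemma mtrace_psd:
  assumes "psd d A"
  shows "Im (mtrace A) = 0" "0 \<le> Re (mtrace A)"
proof -
  have "psdf d (\<lambda>a b. A $$ (a, b))" using assms by (simp add: psd_iff_qform psdf_def)
  from psdf_diag[OF this] show "Im (mtrace A) = 0" "0 \<le> Re (mtrace A)"
    using psd_carrier[OF assms] by (auto simp: mtrace_def intro!: sum_nonneg)
qed

text \<open>With A = V V^\<dagger>, cyclicity turns the trace into that of V^\<dagger> B V, which is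
  positive.\<close>

lemma mtrace_mult_psd:
  assumes "psd d A" "psd d B"
  shows "Im (mtrace (A * B)) = 0" "0 \<le> Re (mtrace (A * B))"
proof -
  obtain V where V: "V \<in> carrier_mat d d" "A = V * adj V" using assms(1) by (rule psd_cholesky)
  have B: "B \<in> carrier_mat d d" using assms(2) by (rule psd_carrier)
  have "mtrace (A * B) = mtrace (V * (adj V * B))" using V B by (simp add: assoc_mult_mat[of _ d d _ d _ d])
  also have "\<dots> = mtrace (adj V * B * adj (adj V))" using V B by (subst mtrace_comm[of _ d d]) auto
  finally have "mtrace (A * B) = mtrace (adj V * B * adj (adj V))" .
  then show "Im (mtrace (A * B)) = 0" "0 \<le> Re (mtrace (A * B))"
    using mtrace_psd[OF psd_conjugate[of "adj V" d d B]] V assms(2) by auto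
qed

lemma psd_add:
  assumes "psd d A" "psd d B"
  shows "psd d (A + B)"
proof -
  have c: "A \<in> carrier_mat d d" "B \<in> carrier_mat d d" using assms by (auto intro: psd_carrier)
  have "qform d (\<lambda>a b. (A + B) $$ (a, b)) v = qform d (\<lambda>a b. A $$ (a, b)) v + qform d (\<lambda>a b. B $$ (a, b)) v" for v
    unfolding qform_def using c by (simp add: algebra_simps flip: sum.distrib)
  then show ?thesis using assms c by (simp add: psd_iff_qform)
qed

lemma psd_smult:
  assumes "psd d A" "0 \<le> c"
  shows "psd d (complex_of_real c \<cdot>\<^sub>m A)"
proof -
  have c: "A \<in> carrier_mat d d" using assms by (auto intro: psd_carrier)
  have "qform d (\<lambda>a b. (complex_of_real c \<cdot>\<^sub>m A) $$ (a, b)) v = of_real c * qform d (\<lambda>a b. A $$ (a, b)) v" for v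
    unfolding qform_def using c by (simp add: sum_distrib_left mult_ac)
  then show ?thesis using assms c by (simp add: psd_iff_qform)
qed

text \<open>Entrywise convergence gives convergence of every quadratic form, and a series of
  nonnegative reals dominates its finite subsums. Applied to measurements and to interpretations,
  this reduces the infinite families to finite ones.\<close>

lemma psd_minus_sum_of_sums:
  assumes "\<And>i. psd d (A i)" "finite I" "B \<in> carrier_mat d d"
    and "\<And>a b. a < d \<Longrightarrow> b < d \<Longrightarrow> (\<lambda>i::nat. A i $$ (a, b)) sums (B $$ (a, b))"
  shows "psd d (B - msum d A I)"
proof -
  define q where "q i v = qform d (\<lambda>a b. A i $$ (a, b)) v" for i v
  have s: "(\<lambda>i. q i v) sums qform d (\<lambda>a b. B $$ (a, b)) v" for v
    unfolding q_def qform_def by (intro sums_sum sums_mult sums_mult2 assms(4)) auto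
  have "(\<Sum>i\<in>I. q i v) = qform d (\<lambda>a b. msum d A I $$ (a, b)) v" for v
    unfolding q_def qform_def using assms(2)
    by (simp add: sum_distrib_left sum_distrib_right sum.swap[of _ I])
  then have eq: "qform d (\<lambda>a b. (B - msum d A I) $$ (a, b)) v = qform d (\<lambda>a b. B $$ (a, b)) v - (\<Sum>i\<in>I. q i v)" for v
    using assms(3) unfolding qform_def by (simp add: right_diff_distrib left_diff_distrib sum_subtractf)
  have pos: "Im (q i v) = 0" "0 \<le> Re (q i v)" for i v
    using assms(1)[of i] by (auto simp: psd_iff_qform q_def)
  have re: "(\<lambda>i. Re (q i v)) sums Re (qform d (\<lambda>a b. B $$ (a, b)) v)"
    and im: "(\<lambda>i. Im (q i v)) sums Im (qform d (\<lambda>a b. B $$ (a, b)) v)" for v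
    using s[of v] by (simp_all add: sums_Re sums_Im)
  have "Im (qform d (\<lambda>a b. B $$ (a, b)) v) = 0" for v
    using im[of v] pos sums_unique2[OF sums_zero] by simp
  moreover have "(\<Sum>i\<in>I. Re (q i v)) \<le> Re (qform d (\<lambda>a b. B $$ (a, b)) v)" for v
    using sum_le_suminf[OF sums_summable[OF re[of v]] assms(2)] pos sums_unique[OF re[of v]] by simp
  ultimately show ?thesis
    using assms(3) pos by (simp add: psd_iff_qform eq minus_carrier_mat)
qed

subsection \<open>Pauli operators\<close>

text \<open>Products X^s Z^q are real matrices, so multiplying them or taking adjoints produces only
  signs, and a sign cancels in \<open>W * X * adj W\<close>. The group law is therefore needed only
  up to sign.\<close>

definition pm_eq :: "complex mat \<Rightarrow> complex mat \<Rightarrow> bool" where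
  "pm_eq A B \<longleftrightarrow> A = B \<or> A = (-1) \<cdot>\<^sub>m B"

lemma pm_eq_kron: "pm_eq A A' \<Longrightarrow> pm_eq B B' \<Longrightarrow> pm_eq (kron A B) (kron A' B')"
  unfolding pm_eq_def by (auto simp: kron_smult_left kron_smult_right)

lemma pm_eq_refl: "pm_eq A A"
  by (simp add: pm_eq_def)

lemma mat2_eqI:
  assumes "A \<in> carrier_mat 2 2" "B \<in> carrier_mat 2 2"
    "A $$ (0,0) = B $$ (0,0)" "A $$ (0,1) = B $$ (0,1)" "A $$ (1,0) = B $$ (1,0)" "A $$ (1,1) = B $$ (1,1)"
  shows "A = B"
  using assms by (intro eq_matI) (auto simp: less_2_cases_iff)

lemma pauli1_eq:
  "pauli1 s q = mat 2 2 (\<lambda>(i, j). if (i \<noteq> j) = s then (if q \<and> j = 1 then -1 else 1) else 0)"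
  unfolding pauli1_def Xmat_def Zmat_def
  by (rule mat2_eqI)
     (auto simp: mat_of_rows_list_def scalar_prod_def numeral_2_eq_2 less_Suc_eq)

lemma pauli1_carrier [simp]: "pauli1 s q \<in> carrier_mat 2 2"
  by (simp add: pauli1_eq)

text \<open>The only sign comes from moving Z of the left factor past X of the right one.\<close>

lemma pauli1_mult: "pm_eq (pauli1 s q * pauli1 s' q') (pauli1 (s \<noteq> s') (q \<noteq> q'))"
proof -
  have "pauli1 s q * pauli1 s' q' = (if q \<and> s' then -1 else 1) \<cdot>\<^sub>m pauli1 (s \<noteq> s') (q \<noteq> q')"
    by (rule mat2_eqI) (auto simp: pauli1_eq scalar_prod_def numeral_2_eq_2)
  then show ?thesis by (auto simp: pm_eq_def)
qed

lemma pauli1_adj: "pm_eq (adj (pauli1 s q)) (pauli1 s q)"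
proof -
  have "adj (pauli1 s q) = (if q \<and> s then -1 else 1) \<cdot>\<^sub>m pauli1 s q"
    by (rule mat2_eqI) (auto simp: pauli1_eq)
  then show ?thesis by (auto simp: pm_eq_def)
qed

text \<open>Completeness relation of the orthogonal basis 1, X, Z, XZ of the 2 by 2
  matrices.\<close>

lemma pauli1_completeness:
  assumes "a < 2" "b < 2" "c < 2" "d < 2"
  shows "(\<Sum>s\<in>UNIV. \<Sum>q\<in>UNIV. pauli1 s q $$ (a, c) * cnj (pauli1 s q $$ (b, d))) = (if a = b \<and> c = d then 2 else 0)"
  using assms by (auto simp: pauli1_eq UNIV_bool less_2_cases_iff)

text \<open>\<open>Upauli\<close> reads positions \<open>i\<close> and \<open>n + i\<close> of a
  single string; recursion along both halves in parallel exposes one tensor factor at a time for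
  inductions on the number of qubits.\<close>

fun pauli_string :: "bool list \<Rightarrow> bool list \<Rightarrow> complex mat" where
  "pauli_string (s # ss) (q # qs) = kron (pauli1 s q) (pauli_string ss qs)"
| "pauli_string _ _ = 1\<^sub>m 1"

lemma foldr_cong_set:
  assumes "\<And>i x. i \<in> set xs \<Longrightarrow> f i x = g i x"
  shows "foldr f xs z = foldr g xs z"
  using assms by (induction xs) auto

lemma Upauli_append:
  assumes "length s = n" "length q = n"
  shows "Upauli n (s @ q) = pauli_string s q"
  using assms
proof (induction n arbitrary: s q)
  case 0
  then show ?case by (simp add: Upauli_def)
next
  case (Suc n)
  then obtain a s' b q' where [simp]: "s = a # s'" "q = b # q'" and len: "length s' = n" "length q' = n"
    by (metis length_Suc_conv)
  have "[0..<Suc n] = 0 # map Suc [0..<n]" by (simp add: upt_conv_Cons map_Suc_upt del: upt_Suc)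
  then have "Upauli (Suc n) (s @ q) = kron (pauli1 a b)
     (foldr (\<lambda>i. kron (pauli1 ((s' @ b # q') ! i) ((s' @ b # q') ! (n + Suc i)))) [0..<n] (1\<^sub>m 1))"
    using len by (simp add: Upauli_def foldr_map o_def nth_append del: upt_Suc)
  also have "foldr (\<lambda>i. kron (pauli1 ((s' @ b # q') ! i) ((s' @ b # q') ! (n + Suc i)))) [0..<n] (1\<^sub>m 1)
      = Upauli n (s' @ q')"
    unfolding Upauli_def using len by (intro foldr_cong_set) (auto simp: nth_append)
  finally show ?case using Suc.IH[OF len] by simp
qed

lemma pauli_string_carrier:
  "length s = n \<Longrightarrow> length q = n \<Longrightarrow> pauli_string s q \<in> carrier_mat (2 ^ n) (2 ^ n)"
proof (induction s q arbitrary: n rule: pauli_string.induct)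
  case (1 s ss q qs)
  then show ?case by (cases n) auto
qed auto

lemma pauli_string_mult:
  assumes "length s = n" "length q = n" "length s' = n" "length q' = n"
  shows "pm_eq (pauli_string s q * pauli_string s' q') (pauli_string (xor_bits s s') (xor_bits q q'))"
  using assms
proof (induction n arbitrary: s q s' q')
  case 0
  then show ?case by (simp add: xor_bits_def pm_eq_refl)
next
  case (Suc n)
  then obtain a b a' b' x y x' y' where [simp]: "s = a # x" "q = b # y" "s' = a' # x'" "q' = b' # y'"
    and len: "length x = n" "length y = n" "length x' = n" "length y' = n"
    by (auto simp: length_Suc_conv)
  show ?case
    using pm_eq_kron[OF pauli1_mult[of a b a' b'] Suc.IH[OF len]] pauli_string_carrier[OF len(1,2)]
      pauli_string_carrier[OF len(3,4)]
    by (simp add: kron_mult[of _ 2 2 _ "2 ^ n" "2 ^ n" _ 2 _ "2 ^ n"] xor_bits_def)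
qed

lemma pauli_string_adj:
  assumes "length s = n" "length q = n"
  shows "pm_eq (adj (pauli_string s q)) (pauli_string s q)"
  using assms
proof (induction n arbitrary: s q)
  case 0
  then show ?case by (simp add: pm_eq_refl)
next
  case (Suc n)
  then obtain a b x y where [simp]: "s = a # x" "q = b # y" and len: "length x = n" "length y = n"
    by (metis length_Suc_conv)
  show ?case
    using pm_eq_kron[OF pauli1_adj[of a b] Suc.IH[OF len]] pauli_string_carrier[OF len]
    by (simp add: adj_kron[of _ 2 2 _ "2 ^ n" "2 ^ n"])
qed

section \<open>Bit strings as an index set\<close>

lemma finite_bitstrings [simp]: "finite (bitstrings m)"
  using finite_lists_length_eq[of "UNIV :: bool set" m] by (simp add: bitstrings_def)

lemma card_bitstrings [simp]: "card (bitstrings m) = 2 ^ m"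
  using card_lists_length_eq[of "UNIV :: bool set" m] by (simp add: bitstrings_def)

lemma bitstrings_0 [simp]: "bitstrings 0 = {[]}"
  by (auto simp: bitstrings_def)

lemma bij_betw_Cons_bitstrings:
  "bij_betw (\<lambda>(b, w). b # w) (UNIV \<times> bitstrings m) (bitstrings (Suc m))"
  by (rule bij_betwI[of _ _ _ "\<lambda>w. (hd w, tl w)"]) (auto simp: bitstrings_def length_Suc_conv)

lemma sum_bitstrings_Suc: "(\<Sum>w\<in>bitstrings (Suc m). f w) = (\<Sum>b\<in>UNIV. \<Sum>w\<in>bitstrings m. f (b # w))"
  using sum.reindex_bij_betw[OF bij_betw_Cons_bitstrings, of f m]
  by (simp add: sum.cartesian_product case_prod_unfold)

lemma bij_betw_append_bitstrings:
  "bij_betw (\<lambda>(v, w). v @ w) (bitstrings m \<times> bitstrings k) (bitstrings (m + k))"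
  by (rule bij_betwI[of _ _ _ "\<lambda>w. (take m w, drop m w)"]) (auto simp: bitstrings_def)

lemma sum_bitstrings_append:
  "(\<Sum>w\<in>bitstrings (m + k). f w) = (\<Sum>v\<in>bitstrings m. \<Sum>w\<in>bitstrings k. f (v @ w))"
  using sum.reindex_bij_betw[OF bij_betw_append_bitstrings, of f m k]
  by (simp add: sum.cartesian_product case_prod_unfold)

text \<open>In block coordinates the sum factors into the relation for the leading qubit and the one
  for the remaining qubits.\<close>

lemma pauli_string_completeness:
  assumes "a < 2 ^ n" "b < 2 ^ n" "c < 2 ^ n" "d < 2 ^ n"
  shows "(\<Sum>s\<in>bitstrings n. \<Sum>q\<in>bitstrings n. pauli_string s q $$ (a, c) * cnj (pauli_string s q $$ (b, d)))
    = (if a = b \<and> c = d then 2 ^ n else 0)"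
  using assms
proof (induction n arbitrary: a b c d)
  case 0
  then show ?case by simp
next
  case (Suc n)
  obtain a1 a2 b1 b2 c1 c2 d1 d2 where [simp]: "a = a1 * 2 ^ n + a2" "b = b1 * 2 ^ n + b2"
      "c = c1 * 2 ^ n + c2" "d = d1 * 2 ^ n + d2"
    and less: "a1 < 2" "b1 < 2" "c1 < 2" "d1 < 2" "a2 < 2 ^ n" "b2 < 2 ^ n" "c2 < 2 ^ n" "d2 < 2 ^ n"
    using Suc.prems unfolding power_Suc by (elim less_multE) blast
  have eq: "x1 * 2 ^ n + x2 = y1 * 2 ^ n + y2 \<longleftrightarrow> x1 = y1 \<and> x2 = y2" if "x2 < 2 ^ n" "y2 < 2 ^ n" for x1 y1 x2 y2 :: nat
    using that by (metis add.commute add_cancel_left_left div_less div_mult_self1 less_nat_zero_code mod_less mod_mult_self3)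
  have ps: "pauli_string (s # ss) (q # qs) $$ (x1 * 2 ^ n + x2, y1 * 2 ^ n + y2) = pauli1 s q $$ (x1, y1) * pauli_string ss qs $$ (x2, y2)"
    if "ss \<in> bitstrings n" "qs \<in> bitstrings n" "x1 < 2" "y1 < 2" "x2 < 2 ^ n" "y2 < 2 ^ n" for s ss q qs x1 x2 y1 y2
    using that pauli_string_carrier[of ss n qs] by (simp add: index_kron[of _ 2 2 _ "2 ^ n" "2 ^ n"] bitstrings_def)
  have "(\<Sum>s\<in>bitstrings (Suc n). \<Sum>q\<in>bitstrings (Suc n). pauli_string s q $$ (a, c) * cnj (pauli_string s q $$ (b, d)))
    = (\<Sum>s\<in>UNIV. \<Sum>ss\<in>bitstrings n. \<Sum>q\<in>UNIV. \<Sum>qs\<in>bitstrings n.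
        (pauli1 s q $$ (a1, c1) * cnj (pauli1 s q $$ (b1, d1))) *
        (pauli_string ss qs $$ (a2, c2) * cnj (pauli_string ss qs $$ (b2, d2))))"
    unfolding sum_bitstrings_Suc using less by (intro sum.cong refl) (simp add: ps del: pauli_string.simps)
  also have "\<dots> = (\<Sum>s\<in>UNIV. \<Sum>q\<in>UNIV. pauli1 s q $$ (a1, c1) * cnj (pauli1 s q $$ (b1, d1))) *
     (\<Sum>ss\<in>bitstrings n. \<Sum>qs\<in>bitstrings n. pauli_string ss qs $$ (a2, c2) * cnj (pauli_string ss qs $$ (b2, d2)))"
    unfolding sum_distrib_right
    by (subst sum.swap[of _ "UNIV :: bool set" "bitstrings n"]) (simp add: sum_distrib_left)
  also have "\<dots> = (if a = b \<and> c = d then 2 ^ Suc n else 0)"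
    unfolding pauli1_completeness[OF less(1-4)] Suc.IH[OF less(5-8)] using eq less by auto
  finally show ?case .
qed

subsection \<open>Conjugation by Pauli operators\<close>

definition Wpauli :: "nat \<Rightarrow> nat \<Rightarrow> bool list \<Rightarrow> complex mat" where
  "Wpauli n dE \<beta> = kron (Upauli n \<beta>) (1\<^sub>m dE)"

lemma Fop_eq: "Fop n dE \<beta> X = Wpauli n dE \<beta> * X * adj (Wpauli n dE \<beta>)"
  by (simp add: Fop_def Wpauli_def Let_def)

lemma bitstrings_halves:
  assumes "\<beta> \<in> bitstrings (2 * n)"
  obtains s q where "length s = n" "length q = n" "\<beta> = s @ q"
  using that[of "take n \<beta>" "drop n \<beta>"] assms by (simp add: bitstrings_def)

lemma Upauli_carrier: "\<beta> \<in> bitstrings (2 * n) \<Longrightarrow> Upauli n \<beta> \<in> carrier_mat (2 ^ n) (2 ^ n)"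
  by (elim bitstrings_halves) (simp add: Upauli_append pauli_string_carrier)

lemma Wpauli_carrier:
  "\<beta> \<in> bitstrings (2 * n) \<Longrightarrow> Wpauli n dE \<beta> \<in> carrier_mat (2 ^ n * dE) (2 ^ n * dE)"
  by (simp add: Wpauli_def Upauli_carrier)

lemma xor_bits_append: "length a = length a' \<Longrightarrow> xor_bits (a @ b) (a' @ b') = xor_bits a a' @ xor_bits b b'"
  by (simp add: xor_bits_def)

lemma xor_bits_bitstrings: "a \<in> bitstrings m \<Longrightarrow> b \<in> bitstrings m \<Longrightarrow> xor_bits a b \<in> bitstrings m"
  by (simp add: xor_bits_def bitstrings_def)

lemma Wpauli_mult:
  assumes "\<beta> \<in> bitstrings (2 * n)" "\<beta>' \<in> bitstrings (2 * n)"
  shows "pm_eq (Wpauli n dE \<beta> * Wpauli n dE \<beta>') (Wpauli n dE (xor_bits \<beta> \<beta>'))"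
proof -
  obtain s q s' q' where *: "length s = n" "length q = n" "\<beta> = s @ q" "length s' = n" "length q' = n" "\<beta>' = s' @ q'"
    using assms by (metis bitstrings_halves)
  have "pm_eq (kron (pauli_string s q * pauli_string s' q') (1\<^sub>m dE))
      (kron (pauli_string (xor_bits s s') (xor_bits q q')) (1\<^sub>m dE))"
    using * by (intro pm_eq_kron pauli_string_mult[of _ n] pm_eq_refl)
  then show ?thesis
    using * pauli_string_carrier[of s n q] pauli_string_carrier[of s' n q']
    by (simp add: Wpauli_def Upauli_append xor_bits_append
        kron_mult[of _ "2 ^ n" "2 ^ n" _ dE dE _ "2 ^ n" _ dE] xor_bits_def)
qed

lemma Wpauli_adj:
  assumes "\<beta> \<in> bitstrings (2 * n)"
  shows "pm_eq (adj (Wpauli n dE \<beta>)) (Wpauli n dE \<beta>)"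
proof -
  obtain s q where *: "length s = n" "length q = n" "\<beta> = s @ q"
    using assms by (metis bitstrings_halves)
  have "pm_eq (kron (adj (pauli_string s q)) (1\<^sub>m dE)) (kron (pauli_string s q) (1\<^sub>m dE))"
    using * by (intro pm_eq_kron pauli_string_adj[of _ n] pm_eq_refl)
  then show ?thesis
    using * pauli_string_carrier[of s n q]
    by (simp add: Wpauli_def Upauli_append adj_kron[of _ "2 ^ n" "2 ^ n" _ dE dE])
qed

lemma pm_eq_conjugate:
  assumes "pm_eq A B" "B \<in> carrier_mat d d" "X \<in> carrier_mat d d"
  shows "A * X * adj A = B * X * adj B"
  using assms by (auto simp: pm_eq_def adj_smult mult_smult_assoc_mat[of _ d d _ d] mult_smult_distrib[of _ d d _ d])

lemma Fop_carrier [simp]: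
  "\<beta> \<in> bitstrings (2 * n) \<Longrightarrow> X \<in> carrier_mat (2 ^ n * dE) (2 ^ n * dE) \<Longrightarrow>
    Fop n dE \<beta> X \<in> carrier_mat (2 ^ n * dE) (2 ^ n * dE)"
  unfolding Fop_eq using Wpauli_carrier[of \<beta> n dE] by (auto intro!: mult_carrier_mat[of _ "2 ^ n * dE" "2 ^ n * dE"])

text \<open>All signs have disappeared: the conjugations are an action of the bit strings under XOR,
  hence commuting involutions.\<close>

lemma Fop_Fop:
  assumes "\<beta> \<in> bitstrings (2 * n)" "\<beta>' \<in> bitstrings (2 * n)" "X \<in> carrier_mat (2 ^ n * dE) (2 ^ n * dE)"
  shows "Fop n dE \<beta> (Fop n dE \<beta>' X) = Fop n dE (xor_bits \<beta> \<beta>') X"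
proof -
  let ?d = "2 ^ n * dE" let ?W = "Wpauli n dE \<beta>" let ?W' = "Wpauli n dE \<beta>'"
  have c: "?W \<in> carrier_mat ?d ?d" "?W' \<in> carrier_mat ?d ?d" using assms by (auto intro: Wpauli_carrier)
  have "?W * (?W' * X * adj ?W') * adj ?W = (?W * ?W') * X * adj (?W * ?W')"
    using c assms(3)
    by (simp add: adj_mult[OF c] assoc_mult_mat[of _ ?d ?d _ ?d _ ?d] mult_carrier_mat[of _ ?d ?d])
  also have "\<dots> = Fop n dE (xor_bits \<beta> \<beta>') X"
    unfolding Fop_eq
    by (rule pm_eq_conjugate[OF Wpauli_mult[OF assms(1,2)] Wpauli_carrier[OF xor_bits_bitstrings[OF assms(1,2)]] assms(3)])
  finally show ?thesis by (simp add: Fop_eq)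
qed

lemma Fop_adj_eq:
  assumes "\<beta> \<in> bitstrings (2 * n)" "X \<in> carrier_mat (2 ^ n * dE) (2 ^ n * dE)"
  shows "adj (Wpauli n dE \<beta>) * X * Wpauli n dE \<beta> = Fop n dE \<beta> X"
  using pm_eq_conjugate[OF Wpauli_adj[OF assms(1)] Wpauli_carrier[OF assms(1)] assms(2)] by (simp add: Fop_eq)

text \<open>Cyclicity replaces \<open>W\<close> by its adjoint, and the adjoint of a Pauli operator
  is the operator itself up to sign.\<close>

lemma mtrace_Fop_mult:
  assumes "\<beta> \<in> bitstrings (2 * n)" "X \<in> carrier_mat (2 ^ n * dE) (2 ^ n * dE)" "Y \<in> carrier_mat (2 ^ n * dE) (2 ^ n * dE)"
  shows "mtrace (Fop n dE \<beta> X * Y) = mtrace (X * Fop n dE \<beta> Y)"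
proof -
  let ?d = "2 ^ n * dE" let ?W = "Wpauli n dE \<beta>"
  have W: "?W \<in> carrier_mat ?d ?d" using assms by (auto intro: Wpauli_carrier)
  have "mtrace (Fop n dE \<beta> X * Y) = mtrace (?W * (X * (adj ?W * Y)))"
    using W assms by (simp add: Fop_eq assoc_mult_mat[of _ ?d ?d _ ?d _ ?d] mult_carrier_mat[of _ ?d ?d])
  also have "\<dots> = mtrace (X * (adj ?W * Y) * ?W)"
    using W assms by (intro mtrace_comm[of _ ?d ?d]) (auto intro!: mult_carrier_mat[of _ ?d ?d])
  also have "\<dots> = mtrace (X * (adj ?W * Y * ?W))"
    using W assms by (simp add: assoc_mult_mat[of _ ?d ?d _ ?d _ ?d] mult_carrier_mat[of _ ?d ?d])
  finally show ?thesis using Fop_adj_eq[OF assms(1,3)] by simp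
qed

lemma adj_Fop:
  assumes "\<beta> \<in> bitstrings (2 * n)" "X \<in> carrier_mat (2 ^ n * dE) (2 ^ n * dE)"
  shows "adj (Fop n dE \<beta> X) = Fop n dE \<beta> (adj X)"
proof -
  let ?d = "2 ^ n * dE" let ?W = "Wpauli n dE \<beta>"
  have W: "?W \<in> carrier_mat ?d ?d" using assms by (auto intro: Wpauli_carrier)
  then show ?thesis
    using assms by (simp add: Fop_eq adj_mult[of _ ?d ?d _ ?d] assoc_mult_mat[of _ ?d ?d _ ?d _ ?d] mult_carrier_mat[of _ ?d ?d])
qed

lemma Fop_msum:
  assumes "\<beta> \<in> bitstrings (2 * n)" "\<And>s. s \<in> S \<Longrightarrow> f s \<in> carrier_mat (2 ^ n * dE) (2 ^ n * dE)"
  shows "Fop n dE \<beta> (msum (2 ^ n * dE) f S) = msum (2 ^ n * dE) (\<lambda>s. Fop n dE \<beta> (f s)) S"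
  unfolding Fop_eq using Wpauli_carrier[OF assms(1), of dE] assms(2)
  by (simp add: msum_mult_left msum_mult_right mult_carrier_mat[of _ "2 ^ n * dE" "2 ^ n * dE"])

lemma Fop_smult:
  assumes "\<beta> \<in> bitstrings (2 * n)" "X \<in> carrier_mat (2 ^ n * dE) (2 ^ n * dE)"
  shows "Fop n dE \<beta> (c \<cdot>\<^sub>m X) = c \<cdot>\<^sub>m Fop n dE \<beta> X"
proof -
  let ?d = "2 ^ n * dE"
  show ?thesis
  unfolding Fop_eq using Wpauli_carrier[OF assms(1), of dE] assms(2)
  by (simp add: mult_smult_assoc_mat[of _ ?d ?d _ ?d] mult_smult_distrib[of _ ?d ?d _ ?d] mult_carrier_mat[of _ ?d ?d])
qed

lemma Fop_minus:
  assumes "\<beta> \<in> bitstrings (2 * n)" "X \<in> carrier_mat (2 ^ n * dE) (2 ^ n * dE)" "Y \<in> carrier_mat (2 ^ n * dE) (2 ^ n * dE)"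
  shows "Fop n dE \<beta> (X - Y) = Fop n dE \<beta> X - Fop n dE \<beta> Y"
proof -
  let ?d = "2 ^ n * dE"
  show ?thesis
  unfolding Fop_eq using Wpauli_carrier[OF assms(1), of dE] assms(2,3)
  by (simp add: mult_minus_distrib_mat[of _ ?d ?d _ ?d] minus_mult_distrib_mat[of _ ?d ?d _ _ ?d] mult_carrier_mat[of _ ?d ?d])
qed

lemma Fop_kron:
  assumes "\<beta> \<in> bitstrings (2 * n)" "A \<in> carrier_mat (2 ^ n) (2 ^ n)" "B \<in> carrier_mat dE dE"
  shows "Fop n dE \<beta> (kron A B) = kron (Fop n 1 \<beta> A) B"
  unfolding Fop_def Let_def kron_one_1_right using Upauli_carrier[OF assms(1)] assms(2,3)
  by (simp add: adj_kron[of _ "2 ^ n" "2 ^ n" _ dE dE] kron_mult[of _ "2 ^ n" "2 ^ n" _ dE dE _ "2 ^ n" _ dE]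
      mult_carrier_mat[of _ "2 ^ n" "2 ^ n"])

text \<open>U \<otimes> 1 commutes with 1 \<otimes> \<sigma>. This is why a weight living on E alone
  leaves the conjugations self-adjoint.\<close>

lemma Fop_mult_one_kron:
  assumes "\<beta> \<in> bitstrings (2 * n)" "X \<in> carrier_mat (2 ^ n * dE) (2 ^ n * dE)" "\<sigma> \<in> carrier_mat dE dE"
  shows "Fop n dE \<beta> (kron (1\<^sub>m (2 ^ n)) \<sigma> * X) = kron (1\<^sub>m (2 ^ n)) \<sigma> * Fop n dE \<beta> X"
proof -
  let ?d = "2 ^ n * dE" let ?W = "Wpauli n dE \<beta>" let ?S = "kron (1\<^sub>m (2 ^ n)) \<sigma>"
  have W: "?W \<in> carrier_mat ?d ?d" using assms by (auto intro: Wpauli_carrier)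
  have S: "?S \<in> carrier_mat ?d ?d" using assms by auto
  have "?W * ?S = ?S * ?W"
    using assms Upauli_carrier[OF assms(1)]
    by (simp add: Wpauli_def kron_mult[of _ "2 ^ n" "2 ^ n" _ dE dE _ "2 ^ n" _ dE])
  then have "?W * (?S * X) = ?S * (?W * X)"
    using W S assms by (simp flip: assoc_mult_mat[of _ ?d ?d _ ?d _ ?d])
  then show ?thesis
    using W S assms by (simp add: Fop_eq assoc_mult_mat[of _ ?d ?d _ ?d _ ?d] mult_carrier_mat[of _ ?d ?d])
qed

text \<open>Entry form of 2^n (1 \<otimes> Tr_A X). The operators are diagonal in the E index, so
  \<open>x\<close> and \<open>y\<close> are untouched, and completeness contracts the A indices
  \<open>c\<close>, \<open>d\<close> to the diagonal.\<close>

lemma msum_Fop_index: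
  assumes "X \<in> carrier_mat (2 ^ n * dE) (2 ^ n * dE)" "a < 2 ^ n" "b < 2 ^ n" "x < dE" "y < dE"
  shows "msum (2 ^ n * dE) (\<lambda>\<beta>. Fop n dE \<beta> X) (bitstrings (2 * n)) $$ (a * dE + x, b * dE + y) =
    (if a = b then 2 ^ n * ptrace_A (2 ^ n) dE X $$ (x, y) else 0)"
proof -
  let ?d = "2 ^ n * dE" let ?U = "\<lambda>\<beta>. Upauli n \<beta>"
  have less: "a * dE + x < ?d" "b * dE + y < ?d" using assms by (auto intro: mult_add_less_mult)
  have "Fop n dE \<beta> X $$ (a * dE + x, b * dE + y) =
      (\<Sum>d<2 ^ n. \<Sum>c<2 ^ n. ?U \<beta> $$ (a, c) * cnj (?U \<beta> $$ (b, d)) * X $$ (c * dE + x, d * dE + y))"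
    if "\<beta> \<in> bitstrings (2 * n)" for \<beta>
  proof -
    have U: "?U \<beta> \<in> carrier_mat (2 ^ n) (2 ^ n)" using that by (rule Upauli_carrier)
    have W: "Wpauli n dE \<beta> \<in> carrier_mat ?d ?d" using that by (rule Wpauli_carrier)
    have Wi: "Wpauli n dE \<beta> $$ (i * dE + p, j * dE + r) = (if p = r then ?U \<beta> $$ (i, j) else 0)"
      if "i < 2 ^ n" "j < 2 ^ n" "p < dE" "r < dE" for i j p r
      using that U by (simp add: Wpauli_def index_kron[of _ "2 ^ n" "2 ^ n" _ dE dE])
    have WX: "(Wpauli n dE \<beta> * X) $$ (a * dE + x, d * dE + z) = (\<Sum>c<2 ^ n. ?U \<beta> $$ (a, c) * X $$ (c * dE + x, d * dE + z))"
      if "d < 2 ^ n" "z < dE" for d z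
      using assms W less that mult_add_less_mult[of d "2 ^ n" z dE]
      by (simp add: index_mult_mat_sum[OF W assms(1)] sum_lessThan_mult Wi if_distrib[of "\<lambda>x. x * _"] sum.delta
          del: index_mult_mat(1) cong: if_cong)
    have "Fop n dE \<beta> X $$ (a * dE + x, b * dE + y) =
      (\<Sum>d<2 ^ n. \<Sum>z<dE. (Wpauli n dE \<beta> * X) $$ (a * dE + x, d * dE + z) * cnj (if y = z then ?U \<beta> $$ (b, d) else 0))"
      unfolding Fop_eq using assms W less mult_add_less_mult[of _ "2 ^ n" _ dE]
      by (subst index_mult_mat_sum[of _ ?d ?d _ ?d])
         (auto simp: sum_lessThan_mult Wi mult_carrier_mat[of _ ?d ?d] simp del: index_mult_mat(1) intro!: sum.cong)
    also have "\<dots> = (\<Sum>d<2 ^ n. (Wpauli n dE \<beta> * X) $$ (a * dE + x, d * dE + y) * cnj (?U \<beta> $$ (b, d)))"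
      using assms(5) by (simp add: if_distrib[of cnj] if_distrib[of "\<lambda>x. _ * x"] sum.delta del: index_mult_mat(1) cong: if_cong)
    also have "\<dots> = (\<Sum>d<2 ^ n. \<Sum>c<2 ^ n. ?U \<beta> $$ (a, c) * cnj (?U \<beta> $$ (b, d)) * X $$ (c * dE + x, d * dE + y))"
      using assms(5) by (intro sum.cong refl) (simp add: WX sum_distrib_left mult_ac del: index_mult_mat(1))
    finally show ?thesis .
  qed
  then have "msum ?d (\<lambda>\<beta>. Fop n dE \<beta> X) (bitstrings (2 * n)) $$ (a * dE + x, b * dE + y) =
     (\<Sum>\<beta>\<in>bitstrings (2 * n). \<Sum>d<2 ^ n. \<Sum>c<2 ^ n. ?U \<beta> $$ (a, c) * cnj (?U \<beta> $$ (b, d)) * X $$ (c * dE + x, d * dE + y))"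
    using less by simp
  also have "\<dots> = (\<Sum>d<2 ^ n. \<Sum>c<2 ^ n. (\<Sum>\<beta>\<in>bitstrings (n + n). ?U \<beta> $$ (a, c) * cnj (?U \<beta> $$ (b, d))) * X $$ (c * dE + x, d * dE + y))"
    unfolding mult_2 sum_distrib_right
    by (subst sum.swap[of _ "bitstrings (n + n)" "{..<2 ^ n}"])+ (rule refl)
  also have "\<dots> = (\<Sum>d<2 ^ n. \<Sum>c<2 ^ n. (if a = b \<and> c = d then 2 ^ n else 0) * X $$ (c * dE + x, d * dE + y))"
  proof (intro sum.cong refl arg_cong2[of _ _ _ _ "(*)"])
    fix c d assume cd: "d \<in> {..<(2::nat) ^ n}" "c \<in> {..<(2::nat) ^ n}"
    have "(\<Sum>\<beta>\<in>bitstrings (n + n). ?U \<beta> $$ (a, c) * cnj (?U \<beta> $$ (b, d))) =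
      (\<Sum>s\<in>bitstrings n. \<Sum>q\<in>bitstrings n. pauli_string s q $$ (a, c) * cnj (pauli_string s q $$ (b, d)))"
      unfolding sum_bitstrings_append by (intro sum.cong refl) (simp add: bitstrings_def Upauli_append)
    then show "(\<Sum>\<beta>\<in>bitstrings (n + n). ?U \<beta> $$ (a, c) * cnj (?U \<beta> $$ (b, d))) = (if a = b \<and> c = d then 2 ^ n else 0)"
      using pauli_string_completeness[OF assms(2,3), of c d] cd by simp
  qed
  also have "\<dots> = (if a = b then 2 ^ n * ptrace_A (2 ^ n) dE X $$ (x, y) else 0)"
    using assms(4,5) by (auto simp: ptrace_A_def if_distrib[of "\<lambda>x. x * _"] sum.delta sum_distrib_left cong: if_cong)
  finally show ?thesis .
qed

subsection \<open>The key schedule\<close>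

lemma bit_add_of_bool: "of_bool a + of_bool b = (of_bool (a \<noteq> b) :: bit)"
  by (cases a; cases b) auto

lemma coeff_poly_of_bits:
  "coeff (poly_of_bits w) i = (if i < length w then of_bool (w ! (length w - 1 - i)) else 0)"
proof -
  have "coeff (poly_of_bits w) i = (\<Sum>j<length w. if length w - 1 - j = i then of_bool (w ! j) else 0)"
    by (simp add: poly_of_bits_def coeff_sum)
  \<comment> \<open>The conjunct \<open>i < length w\<close> is essential: for larger
    \<open>i\<close> the truncated difference is 0 and would wrongly select the first bit.\<close>
  also have "\<dots> = (\<Sum>j<length w. if j = length w - 1 - i \<and> i < length w then of_bool (w ! j) else 0)"
    by (intro sum.cong) auto
  also have "\<dots> = (if i < length w then of_bool (w ! (length w - 1 - i)) else 0)"
    by (auto simp: sum.delta)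
  finally show ?thesis .
qed

lemma poly_of_bits_xor:
  assumes "length a = length b"
  shows "poly_of_bits (xor_bits a b) = poly_of_bits a + poly_of_bits b"
  using assms by (intro poly_eqI) (auto simp: coeff_poly_of_bits xor_bits_def bit_add_of_bool)

lemma length_bits_of_poly [simp]: "length (bits_of_poly m p) = m"
  by (simp add: bits_of_poly_def)

lemma bits_of_poly_add: "bits_of_poly m (p + q) = xor_bits (bits_of_poly m p) (bits_of_poly m q)"
proof (rule nth_equalityI)
  have "(x + y \<noteq> 0) = ((x \<noteq> 0) \<noteq> (y \<noteq> 0))" for x y :: bit
    by (cases x; cases y) auto
  then show "bits_of_poly m (p + q) ! i = xor_bits (bits_of_poly m p) (bits_of_poly m q) ! i"
    if "i < length (bits_of_poly m (p + q))" for i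
    using that by (simp add: bits_of_poly_def xor_bits_def)
qed (simp add: xor_bits_def)

lemma poly_of_bits_of_poly:
  assumes "\<And>i. m \<le> i \<Longrightarrow> coeff p i = 0"
  shows "poly_of_bits (bits_of_poly m p) = p"
proof (rule poly_eqI)
  fix i
  have "of_bool (x \<noteq> 0) = x" for x :: bit by (cases x) auto
  then show "coeff (poly_of_bits (bits_of_poly m p)) i = coeff p i"
    using assms[of i] by (simp add: coeff_poly_of_bits bits_of_poly_def)
qed

lemma bits_of_poly_of_bits: "bits_of_poly (length w) (poly_of_bits w) = w"
  by (rule nth_equalityI) (auto simp: bits_of_poly_def coeff_poly_of_bits)

lemma poly_of_bits_eq_0_iff: "poly_of_bits w = 0 \<longleftrightarrow> w = replicate (length w) False"
proof
  assume "poly_of_bits w = 0"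
  then have "w = bits_of_poly (length w) 0" using bits_of_poly_of_bits[of w] by simp
  also have "\<dots> = replicate (length w) False" by (simp add: bits_of_poly_def map_replicate_const)
  finally show "w = replicate (length w) False" .
next
  assume *: "w = replicate (length w) False"
  have "w ! j = False" if "j < length w" for j
    by (subst *) (simp add: that)
  then show "poly_of_bits w = 0" by (intro poly_eqI) (auto simp: coeff_poly_of_bits)
qed

lemma gf_mult_bitstrings: "gf_mult P u k \<in> bitstrings (degree P)"
  by (simp add: gf_mult_def bitstrings_def)

lemma gf_mult_xor_right:
  assumes "length k = length k'"
  shows "gf_mult P u (xor_bits k k') = xor_bits (gf_mult P u k) (gf_mult P u k')"
  by (simp add: gf_mult_def poly_of_bits_xor[OF assms] distrib_left poly_mod_add_left bits_of_poly_add)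

lemma degree_poly_of_bits_less: "poly_of_bits w \<noteq> 0 \<Longrightarrow> degree (poly_of_bits w) < length w"
  by (rule ccontr) (metis coeff_poly_of_bits leading_coeff_0_iff)

text \<open>Multiplication by a nonzero field element, without constructing the field: P is prime
  and divides no nonzero polynomial of smaller degree, so the map is injective on a finite
  set.\<close>

lemma gf_mult_bij:
  assumes "irreducible P" "length k \<le> degree P" "k \<noteq> replicate (length k) False"
  shows "bij_betw (\<lambda>u. gf_mult P u k) (bitstrings (degree P)) (bitstrings (degree P))"
proof -
  have prime: "prime_elem P" using assms(1) by (rule field_poly_irreducible_imp_prime)
  have nd: "\<not> P dvd poly_of_bits w" if "length w \<le> degree P" "poly_of_bits w \<noteq> 0" for w
    using degree_poly_of_bits_less[OF that(2)] dvd_imp_degree_le[of P "poly_of_bits w"] that by auto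
  have nz: "poly_of_bits k \<noteq> 0" using assms(3) by (simp add: poly_of_bits_eq_0_iff)
  have "inj_on (\<lambda>u. gf_mult P u k) (bitstrings (degree P))"
  proof (rule inj_onI)
    fix u v assume uv: "u \<in> bitstrings (degree P)" "v \<in> bitstrings (degree P)" "gf_mult P u k = gf_mult P v k"
    let ?u = "poly_of_bits u" let ?v = "poly_of_bits v" let ?k = "poly_of_bits k"
    have P0: "P \<noteq> 0" using assms(1) by auto
    have inv: "poly_of_bits (bits_of_poly (degree P) (q mod P)) = q mod P" for q
    proof (rule poly_of_bits_of_poly)
      fix i assume "degree P \<le> i"
      then show "coeff (q mod P) i = 0"
        using degree_mod_less[OF P0, of q] by (auto intro: coeff_eq_0)
    qed
    have "?u * ?k mod P = ?v * ?k mod P"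
      using uv(3) inv unfolding gf_mult_def by metis
    then have "P dvd (?u - ?v) * ?k" by (simp add: mod_eq_dvd_iff left_diff_distrib)
    then have "P dvd ?u - ?v" using prime_elem_dvd_multD[OF prime] nd[OF assms(2) nz] by blast
    \<comment> \<open>Over GF(2) a difference is a sum, so it is again represented by a string of
      length \<open>degree P\<close> and the degree argument applies.\<close>
    moreover have "?u - ?v = poly_of_bits (xor_bits u v)"
    proof -
      have "x - y = x + y" for x y :: bit by (cases x; cases y) auto
      then have "?u - ?v = ?u + ?v" by (intro poly_eqI) (metis coeff_add coeff_diff)
      then show ?thesis using uv(1,2) by (simp add: poly_of_bits_xor bitstrings_def)
    qed
    ultimately have "?u - ?v = 0"
      using nd[of "xor_bits u v"] xor_bits_bitstrings[OF uv(1,2)] by (auto simp: bitstrings_def)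
    then have "?u = ?v" by simp
    then show "u = v" using uv(1,2) bits_of_poly_of_bits by (metis bitstrings_def mem_Collect_eq)
  qed
  moreover have "(\<lambda>u. gf_mult P u k) ` bitstrings (degree P) \<subseteq> bitstrings (degree P)"
    using gf_mult_bitstrings by auto
  ultimately show ?thesis
    by (simp add: bij_betw_def endo_inj_surj)
qed

text \<open>Every suffix has the same number of extensions, so truncating a uniform string keeps it
  uniform.\<close>

lemma sum_lsb:
  assumes "m \<le> L"
  shows "(\<Sum>w\<in>bitstrings L. h (lsb m w)) = 2 ^ (L - m) * (\<Sum>w\<in>bitstrings m. h w :: real)"
proof -
  have "(\<Sum>w\<in>bitstrings L. h (lsb m w)) = (\<Sum>v\<in>bitstrings (L - m). \<Sum>w\<in>bitstrings m. h (lsb m (v @ w)))"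
    using sum_bitstrings_append[of "\<lambda>w. h (lsb m w)" "L - m" m] assms by simp
  also have "\<dots> = (\<Sum>v\<in>bitstrings (L - m). \<Sum>w\<in>bitstrings m. h w)"
    by (intro sum.cong refl) (simp add: lsb_def bitstrings_def)
  finally show ?thesis by simp
qed

section \<open>XOR of the Pauli indices of two keys\<close>

lemma length_xor_bits: "length (xor_bits a b) = min (length a) (length b)"
  by (simp add: xor_bits_def)

lemma xor_bits_self: "xor_bits a a = replicate (length a) False"
  by (auto simp: xor_bits_def intro: nth_equalityI)

lemma xor_bits_cancel: "length a = length b \<Longrightarrow> xor_bits a (xor_bits a b) = b"
  by (auto simp: xor_bits_def intro: nth_equalityI)

lemma bij_betw_xor_bits:
  assumes "a \<in> bitstrings m"
  shows "bij_betw (xor_bits a) (bitstrings m) (bitstrings m)"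
  by (rule bij_betwI[of _ _ _ "xor_bits a"]) (use assms in \<open>auto simp: bitstrings_def xor_bits_cancel length_xor_bits\<close>)

lemma length_lsb: "m \<le> length w \<Longrightarrow> length (lsb m w) = m"
  by (simp add: lsb_def)

lemma lsb_xor:
  assumes "length a = length b"
  shows "lsb m (xor_bits a b) = xor_bits (lsb m a) (lsb m b)"
  using assms by (simp add: lsb_def xor_bits_def drop_map drop_zip)

lemma bkey_bitstrings:
  assumes "l \<le> 2 * n" "degree P = max l (2 * n - l)" "k \<in> bitstrings l" "v \<in> bitstrings (2 * n - l)"
  shows "bkey n l P k u v \<in> bitstrings (2 * n)"
  using assms gf_mult_bitstrings[of P u k] by (simp add: bkey_def bitstrings_def xor_bits_def length_lsb)

text \<open>The mask \<open>v\<close> cancels and multiplication by \<open>u\<close> is additive, so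
  only \<open>u\<close> and the difference of the keys remain.\<close>

lemma xor_bits_bkey:
  assumes "degree P = max l (2 * n - l)" "k \<in> bitstrings l" "k' \<in> bitstrings l" "v \<in> bitstrings (2 * n - l)"
  shows "xor_bits (bkey n l P k u v) (bkey n l P k' u v) =
    xor_bits k k' @ lsb (2 * n - l) (gf_mult P u (xor_bits k k'))"
proof -
  have len: "length (lsb (2 * n - l) (gf_mult P u x)) = 2 * n - l" for x
    using gf_mult_bitstrings[of P u x] assms(1) by (intro length_lsb) (simp add: bitstrings_def)
  have "xor_bits (xor_bits a v) (xor_bits b v) = xor_bits a b" if "length a = length v" "length b = length v" for a b
    using that by (auto simp: xor_bits_def intro!: nth_equalityI)
  then have "xor_bits (xor_bits (lsb (2 * n - l) (gf_mult P u k)) v) (xor_bits (lsb (2 * n - l) (gf_mult P u k')) v)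
     = xor_bits (lsb (2 * n - l) (gf_mult P u k)) (lsb (2 * n - l) (gf_mult P u k'))"
    using assms(4) len by (simp add: bitstrings_def)
  also have "\<dots> = lsb (2 * n - l) (gf_mult P u (xor_bits k k'))"
    using assms gf_mult_bitstrings[of P u] by (simp add: gf_mult_xor_right bitstrings_def lsb_xor)
  finally show ?thesis using assms(2,3) by (simp add: bkey_def xor_bits_append bitstrings_def)
qed

lemma gf_mult_zero: "gf_mult P u (replicate l False) = replicate (degree P) False"
proof -
  have "poly_of_bits (replicate l False) = 0" by (simp add: poly_of_bits_eq_0_iff)
  then show ?thesis by (simp add: gf_mult_def bits_of_poly_def map_replicate_const)
qed

lemma replicate_False_bitstrings [simp]: "replicate m False \<in> bitstrings m"
  by (simp add: bitstrings_def)

text \<open>For a fixed nonzero difference of two keys, the field element \<open>u\<close> times that difference is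
  uniform, so that the difference of the two Pauli indices has a uniform second part.\<close>

lemma sum_xor_bkey:
  fixes g :: "bool list \<Rightarrow> real"
  assumes "l \<le> 2 * n" "irreducible P" "degree P = max l (2 * n - l)"
  defines "m \<equiv> 2 * n - l"
  shows "(\<Sum>(u, v)\<in>bitstrings (degree P) \<times> bitstrings m. \<Sum>k\<in>bitstrings l. \<Sum>k'\<in>bitstrings l.
            g (xor_bits (bkey n l P k u v) (bkey n l P k' u v))) =
    2 ^ degree P * 2 ^ m * 2 ^ l * g (replicate (2 * n) False) +
    2 ^ degree P * 2 ^ l * ((\<Sum>\<beta>\<in>bitstrings (2 * n). g \<beta>) - (\<Sum>w\<in>bitstrings m. g (replicate l False @ w)))"
proof -
  let ?L = "degree P" let ?z = "replicate l False"
  have m: "m \<le> ?L" using assms(3) by (simp add: m_def)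
  define h where "h x = (\<Sum>u\<in>bitstrings ?L. g (x @ lsb m (gf_mult P u x)))" for x
  have hz: "h ?z = 2 ^ ?L * g (replicate (2 * n) False)"
  proof -
    have "lsb m (replicate ?L False) = replicate m False" using m by (simp add: lsb_def)
    moreover have "?z @ replicate m False = replicate (2 * n) False"
      using assms(1) by (simp add: m_def flip: replicate_add)
    ultimately show ?thesis by (simp add: h_def gf_mult_zero)
  qed
  have hnz: "h x = 2 ^ (?L - m) * (\<Sum>w\<in>bitstrings m. g (x @ w))" if "x \<in> bitstrings l - {?z}" for x
  proof -
    have "bij_betw (\<lambda>u. gf_mult P u x) (bitstrings ?L) (bitstrings ?L)"
      using that assms(3) by (intro gf_mult_bij assms(2)) (auto simp: bitstrings_def)
    from sum.reindex_bij_betw[OF this, of "\<lambda>w. g (x @ lsb m w)"]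
    show ?thesis using sum_lsb[OF m, of "\<lambda>w. g (x @ w)"] by (simp add: h_def)
  qed
  have "(\<Sum>(u, v)\<in>bitstrings ?L \<times> bitstrings m. \<Sum>k\<in>bitstrings l. \<Sum>k'\<in>bitstrings l.
            g (xor_bits (bkey n l P k u v) (bkey n l P k' u v)))
      = (\<Sum>u\<in>bitstrings ?L. \<Sum>v\<in>bitstrings m. \<Sum>k\<in>bitstrings l. \<Sum>k'\<in>bitstrings l.
            g (xor_bits k k' @ lsb m (gf_mult P u (xor_bits k k'))))"
    using xor_bits_bkey[OF assms(3)]
    by (simp add: sum.cartesian_product[symmetric] m_def)
  also have "\<dots> = (\<Sum>v\<in>bitstrings m. \<Sum>k\<in>bitstrings l. \<Sum>k'\<in>bitstrings l. h (xor_bits k k'))"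
    unfolding h_def
    by (subst sum.swap[of _ "bitstrings m" "bitstrings ?L"], subst sum.swap[of _ "bitstrings l" "bitstrings ?L"],
        subst sum.swap[of _ "bitstrings l" "bitstrings ?L"]) (rule refl)
  also have "\<dots> = 2 ^ m * (\<Sum>k\<in>bitstrings l. \<Sum>k'\<in>bitstrings l. h (xor_bits k k'))"
    by simp
  \<comment> \<open>For fixed \<open>k\<close> the difference of the two keys runs through all
    strings.\<close>
  also have "(\<Sum>k\<in>bitstrings l. \<Sum>k'\<in>bitstrings l. h (xor_bits k k')) = (\<Sum>k\<in>bitstrings l. \<Sum>x\<in>bitstrings l. h x)"
    by (intro sum.cong refl sum.reindex_bij_betw bij_betw_xor_bits)
  also have "\<dots> = 2 ^ l * (h ?z + (\<Sum>x\<in>bitstrings l - {?z}. h x))"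
    by (simp add: sum.remove[of "bitstrings l" ?z])
  also have "(\<Sum>x\<in>bitstrings l - {?z}. h x) = 2 ^ (?L - m) * (\<Sum>x\<in>bitstrings l - {?z}. \<Sum>w\<in>bitstrings m. g (x @ w))"
    by (simp add: hnz sum_distrib_left)
  \<comment> \<open>Nonzero first parts with arbitrary second parts are all Pauli indices outside
    the subgroup with zero first part.\<close>
  also have "(\<Sum>x\<in>bitstrings l - {?z}. \<Sum>w\<in>bitstrings m. g (x @ w)) =
      (\<Sum>\<beta>\<in>bitstrings (2 * n). g \<beta>) - (\<Sum>w\<in>bitstrings m. g (?z @ w))"
    using sum_bitstrings_append[of g l m] assms(1)
    by (simp add: sum_diff1 m_def)
  finally have *: "(\<Sum>(u, v)\<in>bitstrings ?L \<times> bitstrings m. \<Sum>k\<in>bitstrings l. \<Sum>k'\<in>bitstrings l.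
            g (xor_bits (bkey n l P k u v) (bkey n l P k' u v))) =
     2 ^ m * (2 ^ l * (h ?z + 2 ^ (?L - m) * ((\<Sum>\<beta>\<in>bitstrings (2 * n). g \<beta>) - (\<Sum>w\<in>bitstrings m. g (?z @ w)))))" .
  have e: "2 ^ ?L = (2::real) ^ m * 2 ^ (?L - m)" using m by (simp flip: power_add)
  show ?thesis unfolding * hz e by (simp add: algebra_simps)
qed

subsection \<open>Semi-inner products on matrices\<close>

text \<open>For S = V V^\<dagger> this is the Hilbert-Schmidt product of X V and Y V; it is
  degenerate when \<open>S\<close> is singular.\<close>

definition ip :: "complex mat \<Rightarrow> complex mat \<Rightarrow> complex mat \<Rightarrow> complex" where
  "ip S X Y = mtrace (X * S * adj Y)"

context
  fixes d :: nat and S :: "complex mat"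
  assumes S: "S \<in> carrier_mat d d"
begin

lemma ip_minus_left:
  assumes "X \<in> carrier_mat d d" "X' \<in> carrier_mat d d" "Y \<in> carrier_mat d d"
  shows "ip S (X - X') Y = ip S X Y - ip S X' Y"
  unfolding ip_def using assms S
  by (simp add: minus_mult_distrib_mat[of _ d d _ _ d] mult_carrier_mat[of _ d d] mtrace_minus[of _ d])

lemma ip_minus_right:
  assumes "X \<in> carrier_mat d d" "Y \<in> carrier_mat d d" "Y' \<in> carrier_mat d d"
  shows "ip S X (Y - Y') = ip S X Y - ip S X Y'"
  unfolding ip_def using assms S
  by (simp add: adj_minus[of _ d d] mult_minus_distrib_mat[of _ d d _ d] mult_carrier_mat[of _ d d] mtrace_minus[of _ d])

lemma ip_smult_left:
  assumes "X \<in> carrier_mat d d" "Y \<in> carrier_mat d d"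
  shows "ip S (c \<cdot>\<^sub>m X) Y = c * ip S X Y"
  unfolding ip_def using assms S
  by (simp add: mult_smult_assoc_mat[of _ d d _ d] mult_carrier_mat[of _ d d] mtrace_smult[of _ d])

lemma ip_smult_right:
  assumes "X \<in> carrier_mat d d" "Y \<in> carrier_mat d d"
  shows "ip S X (c \<cdot>\<^sub>m Y) = cnj c * ip S X Y"
  unfolding ip_def using assms S
  by (simp add: adj_smult mult_smult_distrib[of _ d d _ d] mult_carrier_mat[of _ d d] mtrace_smult[of _ d])

lemma ip_msum_left:
  assumes "\<And>s. s \<in> A \<Longrightarrow> f s \<in> carrier_mat d d" "Y \<in> carrier_mat d d"
  shows "ip S (msum d f A) Y = (\<Sum>s\<in>A. ip S (f s) Y)"
  unfolding ip_def using assms S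
  by (simp add: msum_mult_right mult_carrier_mat[of _ d d] mtrace_msum)

lemma ip_msum_right:
  assumes "\<And>s. s \<in> A \<Longrightarrow> f s \<in> carrier_mat d d" "X \<in> carrier_mat d d"
  shows "ip S X (msum d f A) = (\<Sum>s\<in>A. ip S X (f s))"
  unfolding ip_def using assms S
  by (simp add: adj_msum msum_mult_left mult_carrier_mat[of _ d d] mtrace_msum)

end

lemma ip_cnj:
  assumes "psd d S" "X \<in> carrier_mat d d" "Y \<in> carrier_mat d d"
  shows "ip S Y X = cnj (ip S X Y)"
proof -
  have S: "S \<in> carrier_mat d d" "adj S = S" using assms(1) by (auto intro: psd_carrier psd_hermitian)
  have "cnj (ip S X Y) = mtrace (adj (X * S * adj Y))"
    unfolding ip_def using assms S by (subst mtrace_adj[of _ d]) (auto intro!: mult_carrier_mat[of _ d d])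
  also have "adj (X * S * adj Y) = Y * S * adj X"
    using assms S by (simp add: adj_mult[of _ d d _ d] mult_carrier_mat[of _ d d] assoc_mult_mat[of _ d d _ d _ d])
  finally show ?thesis by (simp add: ip_def)
qed

lemma ip_nonneg:
  assumes "psd d S" "X \<in> carrier_mat d d"
  shows "0 \<le> Re (ip S X X)"
  unfolding ip_def using psd_conjugate[OF assms(2,1)] by (rule mtrace_psd)

text \<open>Additive form of Cauchy-Schwarz, from the nonnegative form at X - r Y with r = c and r =
  -c. It is linear in both squared norms, so it can be summed with one fixed
  \<open>c\<close>.\<close>

lemma abs_ip_le:
  assumes "psd d S" "X \<in> carrier_mat d d" "Y \<in> carrier_mat d d" "0 < c"
  shows "\<bar>Re (ip S X Y)\<bar> \<le> c / 2 * Re (ip S Y Y) + Re (ip S X X) / (2 * c)"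
proof -
  have S: "S \<in> carrier_mat d d" using assms(1) by (rule psd_carrier)
  have eq: "Re (ip S (X - complex_of_real r \<cdot>\<^sub>m Y) (X - complex_of_real r \<cdot>\<^sub>m Y)) =
      Re (ip S X X) - 2 * r * Re (ip S X Y) + r\<^sup>2 * Re (ip S Y Y)" for r
    using assms(2,3) ip_cnj[OF assms(1,2,3)]
    by (simp add: ip_minus_left[OF S] ip_minus_right[OF S] ip_smult_left[OF S] ip_smult_right[OF S]
        minus_carrier_mat power2_eq_square algebra_simps)
  have "0 \<le> Re (ip S X X) - 2 * r * Re (ip S X Y) + r\<^sup>2 * Re (ip S Y Y)" for r
    using ip_nonneg[OF assms(1), of "X - complex_of_real r \<cdot>\<^sub>m Y"] assms(2,3)
    unfolding eq by (simp add: minus_carrier_mat)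
  from this[of c] this[of "-c"] have "2 * c * \<bar>Re (ip S X Y)\<bar> \<le> c\<^sup>2 * Re (ip S Y Y) + Re (ip S X X)"
    by (cases "0 \<le> Re (ip S X Y)") auto
  then show ?thesis using assms(4) by (simp add: field_simps power2_eq_square)
qed

text \<open>An effect satisfies M^2 \<le> M, and for Hermitian \<open>M\<close> the left side is the
  trace of S M^2.\<close>

lemma ip_self_le_trace:
  assumes "psd d S" "psd d M" "psd d (1\<^sub>m d - M)"
  shows "Re (ip S M M) \<le> Re (mtrace (S * M))"
proof -
  have c: "S \<in> carrier_mat d d" "M \<in> carrier_mat d d" using assms by (auto intro: psd_carrier)
  let ?N = "1\<^sub>m d - M"
  have N: "?N \<in> carrier_mat d d" using c by (simp add: minus_carrier_mat)
  have h: "adj M = M" "adj ?N = ?N" using assms by (auto intro: psd_hermitian)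
  have MM: "M * M \<in> carrier_mat d d" "M * M * M \<in> carrier_mat d d"
    using c by (auto intro!: mult_carrier_mat[of _ d d])
  \<comment> \<open>Writes M - M^2 as a sum of two conjugated effects, which makes its positivity
    visible without diagonalising \<open>M\<close>.\<close>
  have "M * ?N * M + ?N * M * ?N = M - M * M"
  proof -
    have 1: "M * ?N = M - M * M" "?N * M = M - M * M"
      using c by (simp_all add: mult_minus_distrib_mat[of _ d d _ d] minus_mult_distrib_mat[of _ d d _ _ d])
    have 2: "M * ?N * M = M * M - M * M * M" "?N * M * ?N = M - M * M - (M * M - M * M * M)"
      unfolding 1 using c MM by (simp_all add: minus_carrier_mat mult_minus_distrib_mat[of _ d d _ d] minus_mult_distrib_mat[of _ d d _ _ d])
    show ?thesis unfolding 2 using c MM by (intro eq_matI) (auto simp del: index_mult_mat(1))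
  qed
  moreover have "psd d (M * ?N * M + ?N * M * ?N)"
    using psd_conjugate[OF c(2) assms(3)] psd_conjugate[OF N assms(2)] by (intro psd_add) (simp_all add: h)
  ultimately have "0 \<le> Re (mtrace (S * (M - M * M)))"
    using mtrace_mult_psd(2)[OF assms(1)] by metis
  also have "mtrace (S * (M - M * M)) = mtrace (S * M) - mtrace (S * (M * M))"
    using c MM by (simp add: mult_minus_distrib_mat[of _ d d _ d] mtrace_minus[of _ d] mult_carrier_mat[of _ d d])
  also have "mtrace (S * (M * M)) = mtrace (S * M * M)"
    using c by simp
  also have "\<dots> = ip S M M"
    unfolding ip_def h using c by (subst mtrace_comm[of _ d d]) (auto intro!: mult_carrier_mat[of _ d d])
  finally show ?thesis by simp
qed

subsection \<open>The encryption channel for fixed public randomness\<close>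

lemma Re_of_real_mult: "Re (complex_of_real c * z) = c * Re z"
  by simp

lemma pauli_string_zero: "pauli_string (replicate n False) (replicate n False) = 1\<^sub>m (2 ^ n)"
proof (induction n)
  case (Suc n)
  then show ?case by (simp add: pauli1_def kron_one)
qed simp

lemma Fop_zero:
  assumes "X \<in> carrier_mat (2 ^ n * dE) (2 ^ n * dE)"
  shows "Fop n dE (replicate (2 * n) False) X = X"
  using assms by (simp add: mult_2 replicate_add Fop_eq Wpauli_def Upauli_append pauli_string_zero kron_one)

section \<open>The full Pauli average\<close>

definition twirl :: "nat \<Rightarrow> nat \<Rightarrow> complex mat \<Rightarrow> complex mat" where
  "twirl n dE X = (1 / 4 ^ n) \<cdot>\<^sub>m msum (2 ^ n * dE) (\<lambda>\<beta>. Fop n dE \<beta> X) (bitstrings (2 * n))"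

lemma twirl_carrier [simp]: "twirl n dE X \<in> carrier_mat (2 ^ n * dE) (2 ^ n * dE)"
  by (simp add: twirl_def)

text \<open>By completeness the average sees only the reduced state on E. This equality replaces an
  explicit formula for the twirled state.\<close>

lemma twirl_cong_ptrace:
  assumes "X \<in> carrier_mat (2 ^ n * dE) (2 ^ n * dE)" "Y \<in> carrier_mat (2 ^ n * dE) (2 ^ n * dE)"
    and "ptrace_A (2 ^ n) dE X = ptrace_A (2 ^ n) dE Y"
  shows "twirl n dE X = twirl n dE Y"
proof -
  have "msum (2 ^ n * dE) (\<lambda>\<beta>. Fop n dE \<beta> X) (bitstrings (2 * n)) = msum (2 ^ n * dE) (\<lambda>\<beta>. Fop n dE \<beta> Y) (bitstrings (2 * n))"
    by (rule eq_mat_kronI[of _ "2 ^ n" dE "2 ^ n" dE]) (simp_all add: msum_Fop_index assms del: index_msum)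
  then show ?thesis by (simp add: twirl_def)
qed

text \<open>Shifting by \<beta> permutes the indices over which the average runs.\<close>

lemma Fop_twirl:
  assumes "\<beta> \<in> bitstrings (2 * n)" "X \<in> carrier_mat (2 ^ n * dE) (2 ^ n * dE)"
  shows "Fop n dE \<beta> (twirl n dE X) = twirl n dE X"
proof -
  have "Fop n dE \<beta> (twirl n dE X) = (1 / 4 ^ n) \<cdot>\<^sub>m msum (2 ^ n * dE) (\<lambda>\<beta>'. Fop n dE (xor_bits \<beta> \<beta>') X) (bitstrings (2 * n))"
    unfolding twirl_def using assms by (auto simp: Fop_smult Fop_msum Fop_Fop intro!: arg_cong[of _ _ "smult_mat _"] msum_cong)
  also have "msum (2 ^ n * dE) (\<lambda>\<beta>'. Fop n dE (xor_bits \<beta> \<beta>') X) (bitstrings (2 * n)) = msum (2 ^ n * dE) (\<lambda>\<beta>'. Fop n dE \<beta>' X) (bitstrings (2 * n))"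
    by (rule msum_reindex_bij_betw[OF bij_betw_xor_bits[OF assms(1)]])
  finally show ?thesis by (simp add: twirl_def)
qed

lemma twirl_twirl:
  assumes "X \<in> carrier_mat (2 ^ n * dE) (2 ^ n * dE)"
  shows "twirl n dE (twirl n dE X) = twirl n dE X"
proof -
  have "twirl n dE (twirl n dE X) = (1 / 4 ^ n) \<cdot>\<^sub>m msum (2 ^ n * dE) (\<lambda>\<beta>. twirl n dE X) (bitstrings (2 * n))"
    unfolding twirl_def[of n dE "twirl n dE X"] using assms
    by (intro arg_cong[of _ _ "smult_mat _"] msum_cong) (simp add: Fop_twirl)
  also have "\<dots> = twirl n dE X"
    by (simp add: msum_const power_mult) (intro eq_matI; simp)
  finally show ?thesis .
qed

lemma twirl_minus:
  assumes "X \<in> carrier_mat (2 ^ n * dE) (2 ^ n * dE)" "Y \<in> carrier_mat (2 ^ n * dE) (2 ^ n * dE)"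
  shows "twirl n dE (X - Y) = twirl n dE X - twirl n dE Y"
proof -
  let ?d = "2 ^ n * dE" let ?B = "bitstrings (2 * n)"
  have "dim_row (Fop n dE \<beta> Y) = ?d \<and> dim_col (Fop n dE \<beta> Y) = ?d" if "\<beta> \<in> ?B" for \<beta>
    using Fop_carrier[OF that assms(2)] by auto
  then have "msum ?d (\<lambda>\<beta>. Fop n dE \<beta> (X - Y)) ?B =
      msum ?d (\<lambda>\<beta>. Fop n dE \<beta> X) ?B - msum ?d (\<lambda>\<beta>. Fop n dE \<beta> Y) ?B"
    using assms by (intro eq_matI) (auto simp: Fop_minus sum_subtractf)
  then show ?thesis
    unfolding twirl_def by (intro eq_matI) (auto simp: right_diff_distrib diff_divide_distrib)
qed

lemma mtrace_twirl_mult: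
  assumes "X \<in> carrier_mat (2 ^ n * dE) (2 ^ n * dE)" "Y \<in> carrier_mat (2 ^ n * dE) (2 ^ n * dE)"
  shows "mtrace (twirl n dE X * Y) = mtrace (X * twirl n dE Y)"
proof -
  let ?d = "2 ^ n * dE"
  show ?thesis
    unfolding twirl_def using assms
    by (simp add: mult_smult_assoc_mat[of _ ?d ?d _ ?d] mult_smult_distrib[of _ ?d ?d _ ?d] mult_carrier_mat[of _ ?d ?d]
        mtrace_smult[of _ ?d] msum_mult_left msum_mult_right mtrace_msum mtrace_Fop_mult)
qed

definition Renc :: "nat \<Rightarrow> nat \<Rightarrow> bit poly \<Rightarrow> nat \<Rightarrow> bool list \<times> bool list \<Rightarrow> complex mat \<Rightarrow> complex mat" where
  "Renc n l P dE = (\<lambda>(u, v) X. (1 / 2 ^ l) \<cdot>\<^sub>m msum (2 ^ n * dE) (\<lambda>k. Fop n dE (bkey n l P k u v) X) (bitstrings l))"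

lemma Renc_carrier [simp]: "Renc n l P dE w X \<in> carrier_mat (2 ^ n * dE) (2 ^ n * dE)"
  by (simp add: Renc_def split: prod.split)

abbreviation public_strings :: "nat \<Rightarrow> nat \<Rightarrow> bit poly \<Rightarrow> (bool list \<times> bool list) set" where
  "public_strings n l P \<equiv> bitstrings (degree P) \<times> bitstrings (2 * n - l)"

context
  fixes n l dE :: nat and P :: "bit poly"
  assumes l: "l \<le> 2 * n" and P: "irreducible P" "degree P = max l (2 * n - l)"
begin

private abbreviation "d \<equiv> 2 ^ n * dE"
private abbreviation "F \<equiv> Fop n dE"
private abbreviation "T \<equiv> twirl n dE"
private abbreviation "R \<equiv> Renc n l P dE"
private abbreviation "W \<equiv> public_strings n l P"

private lemma bkey [simp]:
  "k \<in> bitstrings l \<Longrightarrow> v \<in> bitstrings (2 * n - l) \<Longrightarrow> bkey n l P k u v \<in> bitstrings (2 * n)"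
  using bkey_bitstrings[OF l P(2)] .

lemma Renc_twirl:
  assumes "w \<in> W" "X \<in> carrier_mat d d"
  shows "R w (T X) = T X"
proof -
  have "R w (T X) = (1 / 2 ^ l) \<cdot>\<^sub>m msum d (\<lambda>k. T X) (bitstrings l)"
    using assms by (auto simp: Renc_def Fop_twirl intro!: arg_cong[of _ _ "smult_mat _"] msum_cong)
  also have "\<dots> = T X"
    by (simp add: msum_const) (intro eq_matI; simp)
  finally show ?thesis .
qed

lemma Renc_minus:
  assumes "w \<in> W" "X \<in> carrier_mat d d" "Y \<in> carrier_mat d d"
  shows "R w (X - Y) = R w X - R w Y"
proof -
  obtain u v where w: "w = (u, v)" "v \<in> bitstrings (2 * n - l)" using assms(1) by auto
  have "dim_row (F (bkey n l P k u v) Y) = d \<and> dim_col (F (bkey n l P k u v) Y) = d" if "k \<in> bitstrings l" for k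
    using Fop_carrier[OF bkey[OF that w(2)] assms(3)] by auto
  then have "msum d (\<lambda>k. F (bkey n l P k u v) (X - Y)) (bitstrings l) =
      msum d (\<lambda>k. F (bkey n l P k u v) X) (bitstrings l) - msum d (\<lambda>k. F (bkey n l P k u v) Y) (bitstrings l)"
    using assms w by (intro eq_matI) (auto simp: Fop_minus sum_subtractf)
  then show ?thesis
    unfolding Renc_def w by (intro eq_matI) (auto simp: right_diff_distrib diff_divide_distrib)
qed

lemma mtrace_Renc_mult:
  assumes "w \<in> W" "X \<in> carrier_mat d d" "Y \<in> carrier_mat d d"
  shows "mtrace (R w X * Y) = mtrace (X * R w Y)"
  using assms unfolding Renc_def
  by (auto simp: mult_smult_assoc_mat[of _ d d _ d] mult_smult_distrib[of _ d d _ d] mult_carrier_mat[of _ d d]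
        mtrace_smult[of _ d] msum_mult_left msum_mult_right mtrace_msum mtrace_Fop_mult)

context
  fixes \<sigma> :: "complex mat"
  assumes \<sigma>: "psd dE \<sigma>"
begin

private abbreviation "S \<equiv> kron (1\<^sub>m (2 ^ n)) \<sigma>"

private lemma psd_S: "psd d S"
  by (intro psd_kron psd_one \<sigma>)

private lemmas S = psd_carrier[OF psd_S]

text \<open>The weight passes through the conjugation, which leaves the self-adjointness under the
  plain trace.\<close>

private lemma ip_Fop:
  assumes "\<beta> \<in> bitstrings (2 * n)" "X \<in> carrier_mat d d" "Y \<in> carrier_mat d d"
  shows "ip S (F \<beta> X) Y = ip S X (F \<beta> Y)"
proof -
  have "ip S (F \<beta> X) Y = mtrace (F \<beta> X * (S * adj Y))"
    unfolding ip_def using assms S by (simp add: assoc_mult_mat[of _ d d _ d _ d])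
  also have "\<dots> = mtrace (X * F \<beta> (S * adj Y))"
    using assms S by (intro mtrace_Fop_mult) (auto intro!: mult_carrier_mat[of _ d d])
  also have "F \<beta> (S * adj Y) = S * adj (F \<beta> Y)"
    using assms psd_carrier[OF \<sigma>] by (simp add: Fop_mult_one_kron adj_Fop)
  finally show ?thesis
    unfolding ip_def using assms S by (simp add: assoc_mult_mat[of _ d d _ d _ d])
qed

private lemma ip_twirl:
  assumes "X \<in> carrier_mat d d" "Y \<in> carrier_mat d d"
  shows "ip S (T X) Y = ip S X (T Y)"
  unfolding twirl_def using assms
  by (simp add: ip_smult_left[OF S] ip_smult_right[OF S] ip_msum_left[OF S] ip_msum_right[OF S] ip_Fop)

private lemma ip_Renc:
  assumes "w \<in> W" "X \<in> carrier_mat d d" "Y \<in> carrier_mat d d"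
  shows "ip S (R w X) Y = ip S X (R w Y)"
  unfolding Renc_def using assms
  by (auto simp add: ip_smult_left[OF S] ip_smult_right[OF S] ip_msum_left[OF S] ip_msum_right[OF S] ip_Fop)

text \<open>\<open>R w\<close> and T are self-adjoint and \<open>R w\<close> fixes the range of T,
  so \<open>R w\<close> after centring is self-adjoint too.\<close>

private lemma ip_Renc_centred:
  assumes "w \<in> W" "X \<in> carrier_mat d d" "Y \<in> carrier_mat d d"
  shows "ip S (R w (X - T X)) Y = ip S X (R w (Y - T Y))"
proof -
  have "ip S (R w (X - T X)) Y = ip S X (R w Y) - ip S (T X) (R w Y)"
    using assms by (simp add: ip_Renc ip_minus_left[OF S] minus_carrier_mat)
  also have "ip S (T X) (R w Y) = ip S X (T Y)"
    using assms by (simp add: Renc_twirl ip_twirl flip: ip_Renc)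
  finally show ?thesis
    using assms by (simp add: Renc_minus Renc_twirl ip_minus_right[OF S])
qed

text \<open>T is idempotent and self-adjoint, hence an orthogonal projection, and removing its part
  cannot increase the norm.\<close>

private lemma ip_centred_le:
  assumes "X \<in> carrier_mat d d"
  shows "Re (ip S (X - T X) (X - T X)) \<le> Re (ip S X X)"
proof -
  have "ip S (T X) X = ip S (T X) (T X)" "ip S X (T X) = ip S (T X) (T X)"
    using assms ip_twirl[of "T X" X] ip_twirl[of X "T X"] by (simp_all add: twirl_twirl)
  then have "Re (ip S (X - T X) (X - T X)) = Re (ip S X X) - Re (ip S (T X) (T X))"
    using assms by (simp add: ip_minus_left[OF S] ip_minus_right[OF S] minus_carrier_mat)
  then show ?thesis using ip_nonneg[OF psd_S, of "T X"] by simp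
qed

private lemma ip_Fop_Fop:
  assumes "\<beta> \<in> bitstrings (2 * n)" "\<beta>' \<in> bitstrings (2 * n)" "X \<in> carrier_mat d d"
  shows "ip S (F \<beta> X) (F \<beta>' X) = ip S X (F (xor_bits \<beta> \<beta>') X)"
  using assms by (simp add: ip_Fop Fop_Fop)

private lemma ip_msum_Fop:
  assumes "\<And>k. k \<in> A \<Longrightarrow> b k \<in> bitstrings (2 * n)" "X \<in> carrier_mat d d"
  shows "ip S (msum d (\<lambda>k. F (b k) X) A) (msum d (\<lambda>k. F (b k) X) A) =
    (\<Sum>k\<in>A. \<Sum>k'\<in>A. ip S X (F (xor_bits (b k) (b k')) X))"
proof -
  have "ip S (msum d (\<lambda>k. F (b k) X) A) (msum d (\<lambda>k. F (b k) X) A) =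
      (\<Sum>k\<in>A. ip S (F (b k) X) (msum d (\<lambda>k. F (b k) X) A))"
    using assms by (intro ip_msum_left[OF S]) auto
  also have "\<dots> = (\<Sum>k\<in>A. \<Sum>k'\<in>A. ip S X (F (xor_bits (b k) (b k')) X))"
    using assms by (simp add: ip_msum_right[OF S] ip_Fop_Fop)
  finally show ?thesis .
qed

text \<open>The strings with zero first part form a subgroup, and the sum of its conjugations is a
  multiple of a projection: the squared norm of the sum applied to \<open>X\<close> is the order of
  the subgroup times the quantity in question.\<close>

private lemma sum_ip_subgroup_nonneg:
  assumes "X \<in> carrier_mat d d"
  shows "0 \<le> (\<Sum>w\<in>bitstrings (2 * n - l). Re (ip S X (F (replicate l False @ w) X)))"
proof -
  let ?B = "bitstrings (2 * n - l)" let ?e = "\<lambda>w. replicate l False @ w"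
  have e: "?e w \<in> bitstrings (2 * n)" if "w \<in> ?B" for w using that l by (simp add: bitstrings_def)
  have x: "xor_bits (?e w) (?e w') = ?e (xor_bits w w')" for w w'
    by (simp add: xor_bits_append xor_bits_self)
  have "ip S (msum d (\<lambda>w. F (?e w) X) ?B) (msum d (\<lambda>w. F (?e w) X) ?B)
      = (\<Sum>w\<in>?B. \<Sum>w'\<in>?B. ip S X (F (?e (xor_bits w w')) X))"
    using assms e by (simp add: ip_msum_Fop x)
  also have "\<dots> = (\<Sum>w\<in>?B. \<Sum>w'\<in>?B. ip S X (F (?e w') X))"
    by (rule sum.cong[OF refl], rule sum.reindex_bij_betw[OF bij_betw_xor_bits])
  also have "\<dots> = complex_of_real (2 ^ (2 * n - l)) * (\<Sum>w\<in>?B. ip S X (F (?e w) X))"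
    by simp
  finally have "Re (ip S (msum d (\<lambda>w. F (?e w) X) ?B) (msum d (\<lambda>w. F (?e w) X) ?B)) =
     2 ^ (2 * n - l) * (\<Sum>w\<in>?B. Re (ip S X (F (?e w) X)))"
    by (simp only: Re_of_real_mult Re_sum)
  then show ?thesis
    using ip_nonneg[OF psd_S, of "msum d (\<lambda>w. F (?e w) X) ?B"]
    by (metis msum_carrier not_le mult_pos_neg zero_less_numeral zero_less_power)
qed

text \<open>Expanding the squares over pairs of keys leaves the pairs k = k', plus a multiple of the
  sum over all Pauli indices minus the sum over the subgroup with zero first part. The full sum
  vanishes on centred matrices and the subtracted one is nonnegative. So only \<open>2 ^ l\<close>
  diagonal pairs count, against the normalisation \<open>2 ^ l * 2 ^ l\<close>.\<close>

private lemma sum_ip_Renc_le: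
  assumes "X \<in> carrier_mat d d"
  defines "Y \<equiv> X - T X"
  shows "(\<Sum>w\<in>W. Re (ip S (R w Y) (R w Y))) \<le> 2 ^ degree P * 2 ^ (2 * n - l) / 2 ^ l * Re (ip S X X)"
proof -
  have Y: "Y \<in> carrier_mat d d" using assms by (simp add: minus_carrier_mat)
  define g where "g \<beta> = Re (ip S Y (F \<beta> Y))" for \<beta>
  have "Re (ip S (R (u, v) Y) (R (u, v) Y)) =
      (\<Sum>k\<in>bitstrings l. \<Sum>k'\<in>bitstrings l. g (xor_bits (bkey n l P k u v) (bkey n l P k' u v))) / (2 ^ l * 2 ^ l)"
    if "v \<in> bitstrings (2 * n - l)" for u v
  proof -
    have "ip S (R (u, v) Y) (R (u, v) Y) = (1 / 2 ^ l) * ((1 / 2 ^ l) *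
      (\<Sum>k\<in>bitstrings l. \<Sum>k'\<in>bitstrings l. ip S Y (F (xor_bits (bkey n l P k u v) (bkey n l P k' u v)) Y)))"
      unfolding Renc_def using Y that
      by (simp add: ip_smult_left[OF S] ip_smult_right[OF S] ip_msum_Fop)
    also have "\<dots> = complex_of_real (1 / (2 ^ l * 2 ^ l)) *
      (\<Sum>k\<in>bitstrings l. \<Sum>k'\<in>bitstrings l. ip S Y (F (xor_bits (bkey n l P k u v) (bkey n l P k' u v)) Y))"
      by simp
    finally show ?thesis unfolding g_def by (simp only: Re_of_real_mult Re_sum) simp
  qed
  then have "(\<Sum>w\<in>W. Re (ip S (R w Y) (R w Y))) = (\<Sum>(u, v)\<in>W. \<Sum>k\<in>bitstrings l. \<Sum>k'\<in>bitstrings l.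
      g (xor_bits (bkey n l P k u v) (bkey n l P k' u v))) / (2 ^ l * 2 ^ l)"
    by (subst sum_divide_distrib, intro sum.cong) auto
  also have "\<dots> = (2 ^ degree P * 2 ^ (2 * n - l) * 2 ^ l * g (replicate (2 * n) False) +
    2 ^ degree P * 2 ^ l * ((\<Sum>\<beta>\<in>bitstrings (2 * n). g \<beta>) - (\<Sum>w\<in>bitstrings (2 * n - l). g (replicate l False @ w)))) / (2 ^ l * 2 ^ l)"
    by (simp only: sum_xor_bkey[OF l P])
  also have "\<dots> \<le> (2 ^ degree P * 2 ^ (2 * n - l) * 2 ^ l * Re (ip S X X)) / (2 ^ l * 2 ^ l)"
  proof (intro divide_right_mono)
    have "g (replicate (2 * n) False) = Re (ip S Y Y)" using Y by (simp add: g_def Fop_zero)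
    then have "g (replicate (2 * n) False) \<le> Re (ip S X X)"
      using ip_centred_le[OF assms(1)] by (simp add: Y_def)
    \<comment> \<open>Up to the factor 4^n this is the product of \<open>Y\<close> with T Y, and T Y
      = 0 because T is idempotent.\<close>
    moreover have "(\<Sum>\<beta>\<in>bitstrings (2 * n). g \<beta>) = 0"
    proof -
      have "T Y = T X - T X" using assms by (simp only: twirl_minus twirl_twirl twirl_carrier)
      then have "0 = ip S Y (T Y)" by (simp only: ip_minus_right[OF S Y twirl_carrier twirl_carrier] diff_self)
      also have "\<dots> = (1 / 4 ^ n) * (\<Sum>\<beta>\<in>bitstrings (2 * n). ip S Y (F \<beta> Y))"
        unfolding twirl_def using Y by (simp add: ip_smult_right[OF S] ip_msum_right[OF S])
      finally have "(\<Sum>\<beta>\<in>bitstrings (2 * n). ip S Y (F \<beta> Y)) = 0" by simp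
      then show ?thesis unfolding g_def by (metis Re_sum zero_complex.sel(1))
    qed
    moreover have "0 \<le> (\<Sum>w\<in>bitstrings (2 * n - l). g (replicate l False @ w))"
      unfolding g_def by (rule sum_ip_subgroup_nonneg[OF Y])
    ultimately show "2 ^ degree P * 2 ^ (2 * n - l) * 2 ^ l * g (replicate (2 * n) False) +
      2 ^ degree P * 2 ^ l * ((\<Sum>\<beta>\<in>bitstrings (2 * n). g \<beta>) - (\<Sum>w\<in>bitstrings (2 * n - l). g (replicate l False @ w)))
      \<le> 2 ^ degree P * 2 ^ (2 * n - l) * 2 ^ l * Re (ip S X X)"
      by (smt (verit) mult_left_mono mult_nonneg_nonneg mult_nonneg_nonpos zero_le_power)
  qed simp
  also have "\<dots> = 2 ^ degree P * 2 ^ (2 * n - l) / 2 ^ l * Re (ip S X X)" by simp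
  finally show ?thesis .
qed

text \<open>A duality argument: \<open>N\<close> is paired with itself and each centred encryption
  is moved to the other side, where \<open>sum_ip_Renc_le\<close> applies to the fixed matrix
  \<open>N\<close> although the \<open>M w\<close> vary with \<open>w\<close>. This returns half of
  the left side, which is absorbed.\<close>

lemma ip_average_Renc_le:
  fixes M :: "bool list \<times> bool list \<Rightarrow> complex mat"
  assumes "\<And>w. w \<in> W \<Longrightarrow> M w \<in> carrier_mat d d"
  defines "Dc \<equiv> 2 ^ degree P * 2 ^ (2 * n - l) :: real"
  defines "N \<equiv> msum d (\<lambda>w. complex_of_real (1 / Dc) \<cdot>\<^sub>m R w (M w - T (M w))) W"
  shows "Re (ip S N N) \<le> (\<Sum>w\<in>W. Re (ip S (M w) (M w))) / (2 ^ l * Dc)"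
proof -
  have N: "N \<in> carrier_mat d d" by (simp add: N_def)
  have Dc: "Dc > 0" by (simp add: Dc_def)
  have "ip S N N = (\<Sum>w\<in>W. complex_of_real (1 / Dc) * ip S (R w (M w - T (M w))) N)"
    by (subst (1) N_def) (simp add: ip_msum_left[OF S] ip_smult_left[OF S] N)
  also have "\<dots> = (\<Sum>w\<in>W. complex_of_real (1 / Dc) * ip S (M w) (R w (N - T N)))"
    using assms N by (intro sum.cong refl) (simp add: ip_Renc_centred)
  finally have "Re (ip S N N) = (\<Sum>w\<in>W. Re (ip S (M w) (R w (N - T N)))) / Dc"
    by (simp add: sum_divide_distrib)
  \<comment> \<open>The parameter \<open>c = 2 ^ l\<close> balances the factor Dc / 2^l still to
    come, so that exactly one half of \<open>ip S N N\<close> remains.\<close>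
  also have "\<dots> \<le> (\<Sum>w\<in>W. 2 ^ l / 2 * Re (ip S (R w (N - T N)) (R w (N - T N))) + Re (ip S (M w) (M w)) / (2 * 2 ^ l)) / Dc"
  proof (intro divide_right_mono sum_mono)
    fix w assume "w \<in> W"
    then show "Re (ip S (M w) (R w (N - T N))) \<le> 2 ^ l / 2 * Re (ip S (R w (N - T N)) (R w (N - T N))) + Re (ip S (M w) (M w)) / (2 * 2 ^ l)"
      using abs_ip_le[OF psd_S, of "M w" "R w (N - T N)" "2 ^ l"] assms(1)[of w] by simp
  qed (use Dc in simp)
  also have "\<dots> = 2 ^ l / (2 * Dc) * (\<Sum>w\<in>W. Re (ip S (R w (N - T N)) (R w (N - T N)))) + (\<Sum>w\<in>W. Re (ip S (M w) (M w))) / (2 * 2 ^ l * Dc)"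
    by (simp add: sum.distrib add_divide_distrib flip: sum_divide_distrib sum_distrib_left)
  also have "\<dots> \<le> 2 ^ l / (2 * Dc) * (Dc / 2 ^ l * Re (ip S N N)) + (\<Sum>w\<in>W. Re (ip S (M w) (M w))) / (2 * 2 ^ l * Dc)"
    using sum_ip_Renc_le[OF N] Dc by (intro add_right_mono mult_left_mono) (simp_all add: Dc_def)
  also have "\<dots> = Re (ip S N N) / 2 + (\<Sum>w\<in>W. Re (ip S (M w) (M w))) / (2 ^ l * Dc) / 2"
    using Dc by (simp add: field_simps)
  finally show ?thesis by (simp only: add_divide_distrib[symmetric] pos_le_divide_eq)
qed

end

end

subsection \<open>Principal submatrices and partial traces\<close>

text \<open>With a consecutive range as \<open>h\<close> this is a diagonal block, as for an effect
  given the public string or a summand of Tr_A; with stride \<open>dE\<close> it is a summand of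
  Tr_E.\<close>

definition submat :: "nat \<Rightarrow> (nat \<Rightarrow> nat) \<Rightarrow> complex mat \<Rightarrow> complex mat" where
  "submat k h X = mat k k (\<lambda>(a, b). X $$ (h a, h b))"

lemma submat_carrier [simp]: "submat k h X \<in> carrier_mat k k"
  by (simp add: submat_def)

lemma dim_submat [simp]: "dim_row (submat k h X) = k" "dim_col (submat k h X) = k"
  by (simp_all add: submat_def)

lemma index_submat [simp]: "a < k \<Longrightarrow> b < k \<Longrightarrow> submat k h X $$ (a, b) = X $$ (h a, h b)"
  by (simp add: submat_def)

text \<open>Compression by the 0/1 matrix whose row \<open>a\<close> selects coordinate
  \<open>h a\<close>.\<close>

lemma psd_submat:
  assumes "psd D X" "\<And>a. a < k \<Longrightarrow> h a < D"
  shows "psd k (submat k h X)"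
proof -
  have X: "X \<in> carrier_mat D D" using assms(1) by (rule psd_carrier)
  define V where "V = mat k D (\<lambda>(a, j). if j = h a then 1 else 0 :: complex)"
  have V: "V \<in> carrier_mat k D" by (simp add: V_def)
  have "V * X * adj V = submat k h X"
  proof (rule eq_matI)
    fix a b assume "a < dim_row (submat k h X)" "b < dim_col (submat k h X)"
    then have ab: "a < k" "b < k" by auto
    have VX: "(V * X) $$ (a, j) = X $$ (h a, j)" if "j < D" for j
      using ab that assms(2)[of a] unfolding index_mult_mat_sum[OF V X ab(1) that]
      by (simp add: V_def if_distrib[of "\<lambda>x. x * _"] sum.delta cong: if_cong)
    have "(V * X * adj V) $$ (a, b) = (\<Sum>j<D. (V * X) $$ (a, j) * adj V $$ (j, b))"
      using V X ab by (intro index_mult_mat_sum) (auto intro: mult_carrier_mat)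
    also have "\<dots> = (\<Sum>j<D. if j = h b then X $$ (h a, j) else 0)"
    proof (intro sum.cong refl)
      fix j assume "j \<in> {..<D}"
      moreover from this ab have "adj V $$ (j, b) = (if j = h b then 1 else 0)" by (simp add: V_def)
      ultimately show "(V * X) $$ (a, j) * adj V $$ (j, b) = (if j = h b then X $$ (h a, j) else 0)"
        using VX by (simp del: index_mult_mat(1))
    qed
    finally show "(V * X * adj V) $$ (a, b) = submat k h X $$ (a, b)"
      using ab assms(2)[of b] by simp
  qed (use V X in auto)
  then show ?thesis using psd_conjugate[OF V assms(1)] by simp
qed

lemma psd_zero: "psd d (0\<^sub>m d d)"
  by (simp add: psd_def)

lemma psd_msum:
  assumes "finite I" "\<And>i. i \<in> I \<Longrightarrow> psd d (A i)"
  shows "psd d (msum d A I)"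
  using assms
proof (induction I rule: finite_induct)
  case empty
  have "msum d A {} = 0\<^sub>m d d" by (intro eq_matI) auto
  then show ?case using psd_zero by simp
next
  case (insert i I)
  then have "msum d A (insert i I) = A i + msum d A I"
    using psd_carrier[of d "A i"] by (intro eq_matI) auto
  then show ?case using insert by (simp add: psd_add)
qed

section \<open>Partial traces of states\<close>

lemma ptrace_A_eq_msum: "ptrace_A dA dE X = msum dE (\<lambda>a. submat dE (\<lambda>e. a * dE + e) X) {..<dA}"
  by (intro eq_matI) (auto simp: ptrace_A_def)

lemma ptrace_E_eq_msum: "ptrace_E dA dE X = msum dA (\<lambda>e. submat dA (\<lambda>a. a * dE + e) X) {..<dE}"
  by (intro eq_matI) (auto simp: ptrace_E_def)

lemma ptrace_A_carrier [simp]: "ptrace_A dA dE X \<in> carrier_mat dE dE"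
  by (simp add: ptrace_A_def)

lemma ptrace_E_carrier [simp]: "ptrace_E dA dE X \<in> carrier_mat dA dA"
  by (simp add: ptrace_E_def)

lemma psd_ptrace_A: "psd (dA * dE) X \<Longrightarrow> psd dE (ptrace_A dA dE X)"
  unfolding ptrace_A_eq_msum by (auto intro!: psd_msum psd_submat[of "dA * dE"] mult_add_less_mult)

lemma psd_ptrace_E: "psd (dA * dE) X \<Longrightarrow> psd dA (ptrace_E dA dE X)"
  unfolding ptrace_E_eq_msum by (auto intro!: psd_msum psd_submat[of "dA * dE"] mult_add_less_mult)

lemma mtrace_ptrace_A:
  assumes "X \<in> carrier_mat (dA * dE) (dA * dE)"
  shows "mtrace (ptrace_A dA dE X) = mtrace X"
proof -
  have "mtrace (ptrace_A dA dE X) = (\<Sum>e<dE. \<Sum>a<dA. X $$ (a * dE + e, a * dE + e))"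
    by (simp add: ptrace_A_def mtrace_def)
  also have "\<dots> = (\<Sum>a<dA. \<Sum>e<dE. X $$ (a * dE + e, a * dE + e))" by (rule sum.swap)
  also have "\<dots> = mtrace X" using assms by (simp add: mtrace_def sum_lessThan_mult)
  finally show ?thesis .
qed

lemma mtrace_ptrace_E:
  assumes "X \<in> carrier_mat (dA * dE) (dA * dE)"
  shows "mtrace (ptrace_E dA dE X) = mtrace X"
  using assms by (simp add: ptrace_E_def mtrace_def sum_lessThan_mult)

lemma ptrace_A_kron:
  assumes "A \<in> carrier_mat dA dA" "B \<in> carrier_mat dE dE"
  shows "ptrace_A dA dE (kron A B) = mtrace A \<cdot>\<^sub>m B"
  using assms by (intro eq_matI) (auto simp: ptrace_A_def mtrace_def index_kron[OF assms] sum_distrib_right)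

lemma density_ptrace_A: "density (dA * dE) X \<Longrightarrow> density dE (ptrace_A dA dE X)"
  by (simp add: density_def psd_ptrace_A mtrace_ptrace_A psd_carrier)

lemma density_ptrace_E: "density (dA * dE) X \<Longrightarrow> density dA (ptrace_E dA dE X)"
  by (simp add: density_def psd_ptrace_E mtrace_ptrace_E psd_carrier)

lemma density_kron: "density a A \<Longrightarrow> density b B \<Longrightarrow> density (a * b) (kron A B)"
  by (simp add: density_def psd_kron mtrace_kron[of _ a _ b] psd_carrier)

subsection \<open>Conditional min-entropy\<close>

text \<open>The sum of the moduli of the entries is a crude bound on the largest eigenvalue. Any
  finite bound serves: it makes the maximally mixed state admissible in the min-entropy.\<close>

lemma psd_scalar_minus:
  assumes "psd d A"
  shows "\<exists>c::real. psd d (complex_of_real c \<cdot>\<^sub>m 1\<^sub>m d - A)"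
proof
  let ?A = "\<lambda>a b. A $$ (a, b)"
  define c where "c = (\<Sum>a<d. \<Sum>b<d. cmod (?A a b))"
  have cA: "A \<in> carrier_mat d d" using assms by (rule psd_carrier)
  have *: "Im (qform d ?A v) = 0 \<and> Re (qform d ?A v) \<le> c * (\<Sum>a<d. (cmod (v a))\<^sup>2)" for v
  proof
    show "Im (qform d ?A v) = 0" using assms by (simp add: psd_iff_qform)
    let ?s = "\<Sum>a<d. (cmod (v a))\<^sup>2"
    have le: "cmod (v a) * cmod (v b) \<le> ?s" if "a < d" "b < d" for a b
    proof -
      have "(cmod (v a))\<^sup>2 \<le> ?s" "(cmod (v b))\<^sup>2 \<le> ?s"
        using that member_le_sum[of _ "{..<d}" "\<lambda>a. (cmod (v a))\<^sup>2"] by auto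
      moreover have "2 * (cmod (v a) * cmod (v b)) \<le> (cmod (v a))\<^sup>2 + (cmod (v b))\<^sup>2"
        using sum_squares_bound[of "cmod (v a)" "cmod (v b)"] by simp
      ultimately show ?thesis by linarith
    qed
    have "Re (qform d ?A v) \<le> cmod (qform d ?A v)" by (rule complex_Re_le_cmod)
    also have "\<dots> \<le> (\<Sum>a<d. \<Sum>b<d. cmod (cnj (v a) * ?A a b * v b))"
      unfolding qform_def by (rule order.trans[OF norm_sum sum_mono[OF norm_sum]])
    also have "\<dots> \<le> (\<Sum>a<d. \<Sum>b<d. cmod (?A a b) * ?s)"
    proof (intro sum_mono)
      fix a b assume "a \<in> {..<d}" "b \<in> {..<d}"
      then show "cmod (cnj (v a) * ?A a b * v b) \<le> cmod (?A a b) * ?s"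
        using mult_left_mono[OF le[of a b] norm_ge_zero[of "?A a b"]] by (simp add: norm_mult mult_ac)
    qed
    also have "\<dots> = c * ?s" by (simp add: c_def sum_distrib_right)
    finally show "Re (qform d ?A v) \<le> c * ?s" .
  qed
  have eq: "qform d (\<lambda>a b. (complex_of_real c \<cdot>\<^sub>m 1\<^sub>m d - A) $$ (a, b)) v =
      of_real (c * (\<Sum>a<d. (cmod (v a))\<^sup>2)) - qform d ?A v" for v
  proof -
    have "qform d (\<lambda>a b. (complex_of_real c \<cdot>\<^sub>m 1\<^sub>m d - A) $$ (a, b)) v
      = (\<Sum>a<d. \<Sum>b<d. (if a = b then cnj (v a) * complex_of_real c * v b else 0) - cnj (v a) * ?A a b * v b)"
      unfolding qform_def using cA by (intro sum.cong refl) (simp add: algebra_simps)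
    also have "\<dots> = (\<Sum>a<d. cnj (v a) * complex_of_real c * v a) - qform d ?A v"
      by (simp add: sum_subtractf qform_def)
    also have "(\<Sum>a<d. cnj (v a) * complex_of_real c * v a) = of_real (c * (\<Sum>a<d. (cmod (v a))\<^sup>2))"
      unfolding of_real_mult of_real_sum sum_distrib_left
      by (intro sum.cong refl) (simp add: complex_norm_square mult_ac del: of_real_power)
    finally show ?thesis .
  qed
  show "psd d (complex_of_real c \<cdot>\<^sub>m 1\<^sub>m d - A)"
    unfolding psd_iff_qform eq using cA * by (auto simp: minus_carrier_mat)
qed

text \<open>Comparing traces. This keeps the infimum in the min-entropy away from 0, where its
  logarithm would carry no information.\<close>

lemma feasible_scalar_ge:
  assumes "density (dA * dE) \<phi>" "density dE \<sigma>"
    "psd (dA * dE) (complex_of_real \<mu> \<cdot>\<^sub>m kron (1\<^sub>m dA) \<sigma> - \<phi>)"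
  shows "1 \<le> \<mu> * real dA"
proof -
  have c: "\<sigma> \<in> carrier_mat dE dE" "\<phi> \<in> carrier_mat (dA * dE) (dA * dE)"
    using assms by (auto simp: density_def psd_carrier)
  have "mtrace (complex_of_real \<mu> \<cdot>\<^sub>m kron (1\<^sub>m dA) \<sigma> - \<phi>) = of_real (\<mu> * real dA) - 1"
    using c assms by (simp add: mtrace_minus[of _ "dA * dE"] mtrace_smult[of _ "dA * dE"] mtrace_kron[of _ dA _ dE]
        mtrace_one density_def)
  then show ?thesis using mtrace_psd(2)[OF assms(3)] by simp
qed

text \<open>The supremum in the min-entropy need not be attained, hence the factor 2; it is absorbed by
  the slack in the key length.\<close>

lemma hmin_witness:
  assumes "dA \<ge> 1" "dE \<ge> 1" "density (dA * dE) \<phi>" "t \<le> hmin dA dE \<phi>"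
  obtains \<sigma> \<mu> where "density dE \<sigma>" "psd (dA * dE) (complex_of_real \<mu> \<cdot>\<^sub>m kron (1\<^sub>m dA) \<sigma> - \<phi>)"
    "\<mu> \<le> 2 * 2 powr (- t)"
proof -
  define Feas where "Feas \<sigma> = {\<mu>::real. psd (dA * dE) (complex_of_real \<mu> \<cdot>\<^sub>m kron (1\<^sub>m dA) \<sigma> - \<phi>)}" for \<sigma>
  define \<Sigma> where "\<Sigma> = {\<sigma>. density dE \<sigma> \<and> Feas \<sigma> \<noteq> {}}"
  have hm: "hmin dA dE \<phi> = Sup ((\<lambda>\<sigma>. - log 2 (Inf (Feas \<sigma>))) ` \<Sigma>)"
    unfolding hmin_def \<Sigma>_def Feas_def by (rule arg_cong[of _ _ Sup]) auto
  have inf: "1 / real dA \<le> Inf (Feas \<sigma>)" if "\<sigma> \<in> \<Sigma>" for \<sigma>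
  proof (rule cInf_greatest)
    show "Feas \<sigma> \<noteq> {}" using that by (simp add: \<Sigma>_def)
    fix \<mu> assume "\<mu> \<in> Feas \<sigma>"
    then have "1 \<le> \<mu> * real dA"
      using feasible_scalar_ge[OF assms(3), of \<sigma> \<mu>] that by (auto simp: Feas_def \<Sigma>_def)
    then show "1 / real dA \<le> \<mu>" using assms(1) by (simp add: field_simps)
  qed
  \<comment> \<open>The maximally mixed state on E is a candidate; without one the supremum would
    run over the empty set.\<close>
  have "\<Sigma> \<noteq> {}"
  proof -
    obtain c where c: "psd (dA * dE) (complex_of_real c \<cdot>\<^sub>m 1\<^sub>m (dA * dE) - \<phi>)"
      using psd_scalar_minus assms(3) unfolding density_def by blast
    define \<sigma> where "\<sigma> = complex_of_real (1 / real dE) \<cdot>\<^sub>m 1\<^sub>m dE"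
    have "psd dE \<sigma>" unfolding \<sigma>_def by (intro psd_smult psd_one) simp
    moreover have "mtrace \<sigma> = 1" using assms(2) by (simp add: \<sigma>_def mtrace_smult[of _ dE] mtrace_one)
    moreover have "complex_of_real (c * real dE) \<cdot>\<^sub>m kron (1\<^sub>m dA) \<sigma> = complex_of_real c \<cdot>\<^sub>m 1\<^sub>m (dA * dE)"
      using assms(2) by (intro eq_matI) (auto simp: \<sigma>_def kron_smult_right kron_one)
    ultimately have "\<sigma> \<in> \<Sigma>" using c by (auto simp: \<Sigma>_def Feas_def density_def intro!: exI[of _ "c * real dE"])
    then show ?thesis by blast
  qed
  \<comment> \<open>A strict inequality is needed to pick a member below the supremum. With exponent
    1 - t there is still room to pick \<mu> above the infimum.\<close>
  moreover have "t - 1 / 2 < Sup ((\<lambda>\<sigma>. - log 2 (Inf (Feas \<sigma>))) ` \<Sigma>)"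
    using assms(4) hm by simp
  ultimately obtain \<sigma> where \<sigma>: "\<sigma> \<in> \<Sigma>" "t - 1 / 2 < - log 2 (Inf (Feas \<sigma>))"
    using less_cSupD[of "(\<lambda>\<sigma>. - log 2 (Inf (Feas \<sigma>))) ` \<Sigma>" "t - 1 / 2"] by auto
  have pos: "0 < Inf (Feas \<sigma>)" using inf[OF \<sigma>(1)] assms(1)
    by (smt (verit) divide_pos_pos of_nat_1 of_nat_mono)
  have "log 2 (Inf (Feas \<sigma>)) < 1 - t" using \<sigma>(2) by simp
  then have "Inf (Feas \<sigma>) < 2 powr (1 - t)" using pos by (simp add: log_less_iff)
  moreover have "Feas \<sigma> \<noteq> {}" using \<sigma>(1) by (simp add: \<Sigma>_def)
  ultimately obtain \<mu> where "\<mu> \<in> Feas \<sigma>" "\<mu> < 2 powr (1 - t)"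
    using cInf_lessD by blast
  then show ?thesis
    using that[of \<sigma> \<mu>] \<sigma>(1) by (auto simp: Feas_def \<Sigma>_def powr_diff powr_minus field_simps)
qed

subsection \<open>Security of the scheme\<close>

lemma nat_of_bits_less: "nat_of_bits w < 2 ^ length w"
proof (induction w rule: rev_induct)
  case (snoc b w)
  have "nat_of_bits (w @ [b]) = 2 * nat_of_bits w + of_bool b" by (simp add: nat_of_bits_def)
  then show ?case using snoc by (cases b) auto
qed (simp add: nat_of_bits_def)

lemma proj_carrier [simp]: "proj D i \<in> carrier_mat D D"
  by (simp add: proj_def)

text \<open>Because the register is classical, only the diagonal block of the effect at the public
  string matters.\<close>

lemma mtrace_mult_kron_proj:
  assumes "M \<in> carrier_mat (D * d) (D * d)" "X \<in> carrier_mat d d" "i < D"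
  shows "mtrace (M * kron (proj D i) X) = mtrace (submat d (\<lambda>a. i * d + a) M * X)"
proof -
  have "mtrace (M * kron (proj D i) X) =
    (\<Sum>x<D. \<Sum>a<d. \<Sum>y<D. \<Sum>b<d. M $$ (x * d + a, y * d + b) * kron (proj D i) X $$ (y * d + b, x * d + a))"
    using assms by (subst mtrace_mult[of _ "D * d" "D * d"]) (auto simp: sum_lessThan_mult)
  also have "\<dots> = (\<Sum>x<D. \<Sum>a<d. \<Sum>y<D. if y = i then (if x = i then \<Sum>b<d. M $$ (x * d + a, y * d + b) * X $$ (b, a) else 0) else 0)"
    using assms by (intro sum.cong refl) (auto simp: index_kron[of _ D D _ d d] proj_def)
  also have "\<dots> = (\<Sum>x<D. if x = i then \<Sum>a<d. \<Sum>b<d. M $$ (i * d + a, i * d + b) * X $$ (b, a) else 0)"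
    using assms(3) by (intro sum.cong refl) simp
  also have "\<dots> = mtrace (submat d (\<lambda>a. i * d + a) M * X)"
    using assms by (subst mtrace_mult[of _ d d]) auto
  finally show ?thesis .
qed

definition public_index :: "bool list \<times> bool list \<Rightarrow> nat" where
  "public_index = (\<lambda>(u, v). nat_of_bits (u @ v))"

lemma public_index_less: "w \<in> public_strings n l P \<Longrightarrow> public_index w < 2 ^ degree P * 2 ^ (2 * n - l)"
  using nat_of_bits_less[of "fst w @ snd w"] by (auto simp: public_index_def bitstrings_def power_add)

lemma card_public_strings: "card (public_strings n l P) = 2 ^ degree P * 2 ^ (2 * n - l)"
  by (simp add: card_cartesian_product)

lemma Rchan_eq:
  "Rchan n l P dE X = msum (2 ^ degree P * 2 ^ (2 * n - l) * (2 ^ n * dE))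
     (\<lambda>w. (1 / of_nat (2 ^ degree P * 2 ^ (2 * n - l))) \<cdot>\<^sub>m
        kron (proj (2 ^ degree P * 2 ^ (2 * n - l)) (public_index w)) (Renc n l P dE w X)) (public_strings n l P)"
  unfolding Rchan_def Let_def Renc_def public_index_def by (rule msum_cong) auto

section \<open>Varying the weight, and measurements\<close>

lemma ip_smult_middle:
  assumes "S \<in> carrier_mat d d" "X \<in> carrier_mat d d" "Y \<in> carrier_mat d d"
  shows "ip (c \<cdot>\<^sub>m S) X Y = c * ip S X Y"
  unfolding ip_def using assms
  by (simp add: mult_smult_assoc_mat[of _ d d _ d] mult_smult_distrib[of _ d d _ d] mult_carrier_mat[of _ d d] mtrace_smult[of _ d])

lemma ip_msum_middle:
  assumes "\<And>s. s \<in> A \<Longrightarrow> f s \<in> carrier_mat d d" "X \<in> carrier_mat d d" "Y \<in> carrier_mat d d"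
  shows "ip (msum d f A) X Y = (\<Sum>s\<in>A. ip (f s) X Y)"
  unfolding ip_def using assms
  by (simp add: msum_mult_left msum_mult_right mult_carrier_mat[of _ d d] mtrace_msum)

lemma ip_mono:
  assumes "psd d (B - A)" "A \<in> carrier_mat d d" "B \<in> carrier_mat d d" "X \<in> carrier_mat d d"
  shows "Re (ip A X X) \<le> Re (ip B X X)"
proof -
  have "ip (B - A) X X = ip B X X - ip A X X"
    unfolding ip_def using assms(2-4)
    by (simp add: mult_minus_distrib_mat[of _ d d _ d] minus_mult_distrib_mat[of _ d d _ _ d]
        mult_carrier_mat[of _ d d] mtrace_minus[of _ d])
  then show ?thesis using ip_nonneg[OF assms(1,4)] by simp
qed

text \<open>Injectivity of \<open>h\<close> makes the selected block of the identity an identity, so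
  the blocks are effects with finite sums at most 1. Then M^2 \<le> M turns squared norms into
  traces, and these add up.\<close>

lemma sum_ip_povm_le:
  assumes "psd d S" "povm D M" "finite Y" "\<And>a. a < d \<Longrightarrow> h a < D" "inj_on h {..<d}"
  shows "(\<Sum>y\<in>Y. Re (ip S (submat d h (M y)) (submat d h (M y)))) \<le> Re (mtrace S)"
proof -
  let ?M = "\<lambda>y. submat d h (M y)"
  have S: "S \<in> carrier_mat d d" using assms(1) by (rule psd_carrier)
  have psd: "psd d (?M y)" for y
    using assms by (auto simp: povm_def intro!: psd_submat[of D])
  have le: "psd d (1\<^sub>m d - msum d ?M Z)" if "finite Z" for Z
  proof (rule psd_minus_sum_of_sums[OF psd that])
    fix a b assume ab: "a < d" "b < d"
    have "(\<lambda>i. M i $$ (h a, h b)) sums (1\<^sub>m D $$ (h a, h b))"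
      using assms(2) assms(4)[OF ab(1)] assms(4)[OF ab(2)] unfolding povm_def by blast
    moreover have "1\<^sub>m D $$ (h a, h b) = (1\<^sub>m d $$ (a, b) :: complex)"
      using assms(4)[OF ab(1)] assms(4)[OF ab(2)] assms(5) ab by (auto simp: inj_on_def)
    ultimately show "(\<lambda>i. ?M i $$ (a, b)) sums (1\<^sub>m d $$ (a, b))"
      using ab by simp
  qed simp
  have "Re (ip S (?M y) (?M y)) \<le> Re (mtrace (S * ?M y))" for y
  proof (rule ip_self_le_trace[OF assms(1) psd])
    have "msum d ?M {y} = ?M y" by (intro eq_matI) auto
    then show "psd d (1\<^sub>m d - ?M y)" using le[of "{y}"] by simp
  qed
  then have "(\<Sum>y\<in>Y. Re (ip S (?M y) (?M y))) \<le> (\<Sum>y\<in>Y. Re (mtrace (S * ?M y)))"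
    by (rule sum_mono)
  also have "\<dots> = Re (mtrace (S * msum d ?M Y))"
    using S by (simp add: msum_mult_left mtrace_msum mult_carrier_mat[of _ d d])
  also have "\<dots> = Re (mtrace S) - Re (mtrace (S * (1\<^sub>m d - msum d ?M Y)))"
    using S by (simp add: mult_minus_distrib_mat[of _ d d _ d] mtrace_minus[of _ d] mult_carrier_mat[of _ d d])
  also have "\<dots> \<le> Re (mtrace S)"
    using mtrace_mult_psd(2)[OF assms(1) le[OF assms(3)]] by simp
  finally show ?thesis .
qed

text \<open>The operator N_y of the overview when \<open>M\<close> is the effect of outcome y: the
  centred channel acting on measurements instead of states.\<close>

definition centred_effect :: "nat \<Rightarrow> nat \<Rightarrow> bit poly \<Rightarrow> nat \<Rightarrow> complex mat \<Rightarrow> complex mat" where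
  "centred_effect n l P dE M = msum (2 ^ n * dE)
     (\<lambda>w. complex_of_real (1 / (2 ^ degree P * 2 ^ (2 * n - l))) \<cdot>\<^sub>m
        Renc n l P dE w (submat (2 ^ n * dE) (\<lambda>a. public_index w * (2 ^ n * dE) + a) M
          - twirl n dE (submat (2 ^ n * dE) (\<lambda>a. public_index w * (2 ^ n * dE) + a) M))) (public_strings n l P)"

lemma centred_effect_carrier [simp]: "centred_effect n l P dE M \<in> carrier_mat (2 ^ n * dE) (2 ^ n * dE)"
  by (simp add: centred_effect_def)

context
  fixes n l :: nat and P :: "bit poly"
  assumes l: "l \<le> 2 * n" and P: "irreducible P" "degree P = max l (2 * n - l)"
begin

private abbreviation "Pub \<equiv> public_strings n l P"
private abbreviation "Dc \<equiv> 2 ^ degree P * 2 ^ (2 * n - l) :: nat"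

lemma Renc_kron:
  assumes "w \<in> Pub" "A \<in> carrier_mat (2 ^ n) (2 ^ n)" "B \<in> carrier_mat dE dE"
  shows "kron (Renc n l P 1 w A) B = Renc n l P dE w (kron A B)"
proof -
  have "Fop n 1 \<beta> A \<in> carrier_mat (2 ^ n) (2 ^ n)" if "\<beta> \<in> bitstrings (2 * n)" for \<beta>
    using Fop_carrier[OF that, of A 1] assms by simp
  then show ?thesis
    using assms bkey_bitstrings[OF l P(2)]
    by (auto simp: Renc_def kron_smult_left kron_msum_left Fop_kron intro!: arg_cong[of _ _ "smult_mat _"] msum_cong)
qed

text \<open>Since the channel ignores E, the ideal state is itself an encryption, namely of a
  product state, and both probabilities can be treated alike.\<close>

lemma Rchan_kron:
  assumes "A \<in> carrier_mat (2 ^ n) (2 ^ n)" "B \<in> carrier_mat dE dE"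
  shows "kron (Rchan n l P 1 A) B = Rchan n l P dE (kron A B)"
proof -
  have "kron (proj Dc i) (Renc n l P 1 w A) \<in> carrier_mat (Dc * (2 ^ n * 1)) (Dc * (2 ^ n * 1))" for i w
    by (intro kron_carrier proj_carrier Renc_carrier)
  then show ?thesis
    unfolding Rchan_eq using assms
    by (subst kron_msum_left) (auto simp: kron_smult_left kron_assoc Renc_kron mult.assoc simp del: One_nat_def intro!: msum_cong)
qed

text \<open>\<open>R w\<close> is split into its centred part and T. The centred part goes to the
  effect; T stays on the state, so that the last summand depends on \<open>X\<close> only through
  its twirl.\<close>

lemma mtrace_mult_Rchan:
  fixes dE :: nat
  defines "d \<equiv> 2 ^ n * dE"
  assumes "M \<in> carrier_mat (Dc * d) (Dc * d)" "X \<in> carrier_mat d d"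
  shows "mtrace (M * Rchan n l P dE X) = mtrace (centred_effect n l P dE M * X) +
     (\<Sum>w\<in>Pub. mtrace (submat d (\<lambda>a. public_index w * d + a) M * twirl n dE X)) / of_nat Dc"
proof -
  let ?R = "Renc n l P dE" let ?T = "twirl n dE"
  let ?M = "\<lambda>w. submat d (\<lambda>a. public_index w * d + a) M"
  let ?c = "complex_of_real (1 / (2 ^ degree P * 2 ^ (2 * n - l)))"
  note car = Renc_carrier[of n l P dE, folded d_def] twirl_carrier[of n dE, folded d_def]
  have K: "kron (proj Dc i) (?R w X) \<in> carrier_mat (Dc * d) (Dc * d)" for i w
    by (intro kron_carrier proj_carrier car)
  have c: "1 / of_nat Dc = ?c" by simp
  have "mtrace (M * Rchan n l P dE X) = (\<Sum>w\<in>Pub. ?c * mtrace (M * kron (proj Dc (public_index w)) (?R w X)))"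
    unfolding Rchan_eq c d_def[symmetric] using assms K
    by (subst msum_mult_left, simp, simp, subst mtrace_msum)
       (auto simp: mult_smult_distrib[of _ "Dc * d" "Dc * d" _ "Dc * d"] mtrace_smult[of _ "Dc * d"]
         mult_carrier_mat[of _ "Dc * d" "Dc * d"])
  also have "\<dots> = (\<Sum>w\<in>Pub. ?c * mtrace (?M w * ?R w X))"
    using assms car public_index_less[of _ P n l] by (intro sum.cong refl) (simp add: mtrace_mult_kron_proj)
  also have "\<dots> = (\<Sum>w\<in>Pub. ?c * mtrace (?R w (?M w - ?T (?M w)) * X) + ?c * mtrace (?M w * ?T X))"
  proof (intro sum.cong refl)
    fix w assume w: "w \<in> Pub"
    have "mtrace (?R w (?M w - ?T (?M w)) * X) = mtrace (?R w (?M w) * X) - mtrace (?T (?M w) * X)"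
      using Renc_minus[OF l P w, of "?M w" dE "?T (?M w)"] Renc_twirl[OF l P w, of "?M w" dE] car assms(3)
      unfolding d_def[symmetric]
      by (simp add: minus_mult_distrib_mat[of _ d d _ _ d] mtrace_minus[of _ d] mult_carrier_mat[of _ d d])
    also have "mtrace (?R w (?M w) * X) = mtrace (?M w * ?R w X)"
      using mtrace_Renc_mult[OF l P w, of "?M w" dE X] assms by simp
    also have "mtrace (?T (?M w) * X) = mtrace (?M w * ?T X)"
      using mtrace_twirl_mult[of "?M w" n dE X] assms by simp
    finally show "?c * mtrace (?M w * ?R w X) = ?c * mtrace (?R w (?M w - ?T (?M w)) * X) + ?c * mtrace (?M w * ?T X)"
      by (simp only: right_diff_distrib diff_add_cancel)
  qed
  also have "\<dots> = (\<Sum>w\<in>Pub. ?c * mtrace (?R w (?M w - ?T (?M w)) * X)) + (\<Sum>w\<in>Pub. mtrace (?M w * ?T X)) / of_nat Dc"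
    by (simp add: sum.distrib flip: sum_divide_distrib)
  also have "(\<Sum>w\<in>Pub. ?c * mtrace (?R w (?M w - ?T (?M w)) * X)) = mtrace (centred_effect n l P dE M * X)"
    unfolding centred_effect_def d_def[symmetric] using assms(3) car
    by (subst msum_mult_right)
       (auto simp: mtrace_msum mult_smult_assoc_mat[of _ d d _ d] mtrace_smult[of _ d] mult_carrier_mat[of _ d d])
  finally show ?thesis .
qed

text \<open>For each public string the outcomes contribute at most the trace 2^n of the weight;
  averaging over public strings supplies the factor 2^-l.\<close>

lemma sum_ip_centred_effect_le:
  fixes dE :: nat
  defines "d \<equiv> 2 ^ n * dE"
  assumes "density dE \<sigma>" "povm (Dc * d) M" "finite Y"
  shows "(\<Sum>y\<in>Y. Re (ip (kron (1\<^sub>m (2 ^ n)) \<sigma>) (centred_effect n l P dE (M y)) (centred_effect n l P dE (M y)))) \<le> 2 ^ n / 2 ^ l"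
proof -
  let ?S = "kron (1\<^sub>m (2 ^ n)) \<sigma>" let ?D = "2 ^ degree P * 2 ^ (2 * n - l) :: real"
  let ?M = "\<lambda>w y. submat d (\<lambda>a. public_index w * d + a) (M y)"
  have \<sigma>: "psd dE \<sigma>" using assms(2) by (simp add: density_def)
  have S: "psd d ?S" unfolding d_def by (intro psd_kron psd_one \<sigma>)
  have tr: "mtrace ?S = 2 ^ n"
    using assms(2) psd_carrier[OF \<sigma>] by (simp add: mtrace_kron[of _ "2 ^ n" _ dE] mtrace_one density_def)
  have "(\<Sum>y\<in>Y. Re (ip ?S (centred_effect n l P dE (M y)) (centred_effect n l P dE (M y)))) \<le>
      (\<Sum>y\<in>Y. (\<Sum>w\<in>Pub. Re (ip ?S (?M w y) (?M w y))) / (2 ^ l * ?D))"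
    unfolding centred_effect_def d_def by (intro sum_mono ip_average_Renc_le[OF l P \<sigma>]) simp
  also have "\<dots> = (\<Sum>w\<in>Pub. \<Sum>y\<in>Y. Re (ip ?S (?M w y) (?M w y))) / (2 ^ l * ?D)"
    by (subst sum.swap) (simp only: sum_divide_distrib)
  also have "\<dots> \<le> (\<Sum>w\<in>Pub. 2 ^ n) / (2 ^ l * ?D)"
  proof (intro divide_right_mono sum_mono)
    fix w assume "w \<in> Pub"
    then have "public_index w * d + a < Dc * d" if "a < d" for a
      using public_index_less that by (intro mult_add_less_mult)
    then show "(\<Sum>y\<in>Y. Re (ip ?S (?M w y) (?M w y))) \<le> 2 ^ n"
      using sum_ip_povm_le[OF S assms(3,4), of "\<lambda>a. public_index w * d + a"] by (simp add: tr inj_on_def)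
  qed simp
  also have "\<dots> = 2 ^ n / 2 ^ l" by (simp add: card_public_strings)
  finally show ?thesis .
qed

private abbreviation "CE \<equiv> centred_effect n l P"

text \<open>The half of the argument common to the real and the ideal case. Cauchy-Schwarz with
  weight \<open>\<tau> i\<close> against the identity separates the states from the effects; the
  operator inequality then replaces the states by the fixed weight \<mu> 1 \<otimes>
  \<sigma>.\<close>

lemma sum_abs_mtrace_centred_le:
  fixes dE :: nat
  defines "d \<equiv> 2 ^ n * dE"
  assumes \<sigma>: "density dE \<sigma>" and M: "povm (Dc * d) M"
    and \<rho>: "\<rho> \<in> carrier_mat d d" and le: "psd d (complex_of_real \<mu> \<cdot>\<^sub>m kron (1\<^sub>m (2 ^ n)) \<sigma> - \<rho>)"
    and dec: "decomposition d \<rho> p \<tau>"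
    and \<epsilon>: "0 < \<epsilon>" and \<mu>: "0 \<le> \<mu>" "\<mu> * (2 ^ n / 2 ^ l) \<le> \<epsilon>\<^sup>2 / 4"
  shows "(\<Sum>i<K. \<bar>p i * Re (mtrace (CE dE (M (f i)) * \<tau> i))\<bar>) \<le> \<epsilon> / 2"
proof -
  let ?S = "kron (1\<^sub>m (2 ^ n)) \<sigma>" let ?N = "\<lambda>y. CE dE (M y)"
  have p: "0 \<le> p i" "p sums 1" and \<tau>: "psd d (\<tau> i)" "mtrace (\<tau> i) = 1" for i
    using dec by (auto simp: decomposition_def density_def)
  have N: "?N y \<in> carrier_mat d d" for y by (simp add: d_def)
  have \<tau>c: "\<tau> i \<in> carrier_mat d d" for i using \<tau>(1) by (rule psd_carrier)
  have S: "?S \<in> carrier_mat d d" using \<sigma> by (auto simp: density_def d_def dest: psd_carrier)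
  \<comment> \<open>Any finite part of the interpretation lies below \<rho>, hence below \<mu> 1
    \<otimes> \<sigma>, for one and the same effect.\<close>
  have group: "(\<Sum>i\<in>I. p i * Re (ip (\<tau> i) (?N y) (?N y))) \<le> \<mu> * Re (ip ?S (?N y) (?N y))"
    if "finite I" for I y
  proof -
    have "psd d (\<rho> - msum d (\<lambda>i. complex_of_real (p i) \<cdot>\<^sub>m \<tau> i) I)"
    proof (rule psd_minus_sum_of_sums[OF psd_smult[OF \<tau>(1) p(1)] that \<rho>])
      fix a b assume "a < d" "b < d"
      then show "(\<lambda>i. (complex_of_real (p i) \<cdot>\<^sub>m \<tau> i) $$ (a, b)) sums (\<rho> $$ (a, b))"
        using dec \<tau>c by (auto simp: decomposition_def carrier_matD[OF \<tau>c])
    qed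
    from psd_add[OF le this]
    have "psd d (complex_of_real \<mu> \<cdot>\<^sub>m ?S - msum d (\<lambda>i. complex_of_real (p i) \<cdot>\<^sub>m \<tau> i) I)"
    proof (rule back_subst[of "psd d"])
      show "complex_of_real \<mu> \<cdot>\<^sub>m ?S - \<rho> + (\<rho> - msum d (\<lambda>i. complex_of_real (p i) \<cdot>\<^sub>m \<tau> i) I) =
          complex_of_real \<mu> \<cdot>\<^sub>m ?S - msum d (\<lambda>i. complex_of_real (p i) \<cdot>\<^sub>m \<tau> i) I"
        using S \<rho> by (intro eq_matI) auto
    qed
    from ip_mono[OF this _ _ N[of y]]
    have "Re (ip (msum d (\<lambda>i. complex_of_real (p i) \<cdot>\<^sub>m \<tau> i) I) (?N y) (?N y)) \<le>
        Re (ip (complex_of_real \<mu> \<cdot>\<^sub>m ?S) (?N y) (?N y))"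
      using S by simp
    then show ?thesis
      using \<tau>c N S by (simp add: ip_msum_middle ip_smult_middle[of _ d])
  qed
  \<comment> \<open>Sorting by the value of \<open>f\<close> pays the operator inequality once per
    outcome, not once per index.\<close>
  have "(\<Sum>i<K. p i * Re (ip (\<tau> i) (?N (f i)) (?N (f i)))) =
      (\<Sum>y\<in>f ` {..<K}. \<Sum>i\<in>{i \<in> {..<K}. f i = y}. p i * Re (ip (\<tau> i) (?N y) (?N y)))"
    by (subst sum.group[where g = f and S = "{..<K}" and T = "f ` {..<K}", symmetric]) (auto intro!: sum.cong)
  also have "\<dots> \<le> (\<Sum>y\<in>f ` {..<K}. \<mu> * Re (ip ?S (?N y) (?N y)))"
    by (intro sum_mono group) simp
  also have "\<dots> \<le> \<mu> * (2 ^ n / 2 ^ l)"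
    unfolding sum_distrib_left[symmetric] using M
    by (intro mult_left_mono \<mu> sum_ip_centred_effect_le[OF \<sigma>]) (auto simp: d_def)
  also note \<mu>(2)
  finally have B: "(\<Sum>i<K. p i * Re (ip (\<tau> i) (?N (f i)) (?N (f i)))) \<le> \<epsilon>\<^sup>2 / 4" .
  have "\<bar>p i * Re (mtrace (?N (f i) * \<tau> i))\<bar> \<le> p i * (\<epsilon> / 4) + p i * Re (ip (\<tau> i) (?N (f i)) (?N (f i))) / \<epsilon>" for i
  proof -
    have "ip (\<tau> i) (?N (f i)) (1\<^sub>m d) = mtrace (?N (f i) * \<tau> i)" "ip (\<tau> i) (1\<^sub>m d) (1\<^sub>m d) = 1"
      using N[of "f i"] \<tau>c[of i] \<tau>(2)[of i] by (simp_all add: ip_def mult_carrier_mat[of _ d d] right_mult_one_mat[of _ d d])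
    \<comment> \<open>With parameter \<open>\<epsilon> / 2\<close>, the total weight of the states
      and the squared norms, bounded by \<open>\<epsilon>\<^sup>2 / 4\<close>, each contribute
      \<open>\<epsilon> / 4\<close> after summation.\<close>
    then have "\<bar>Re (mtrace (?N (f i) * \<tau> i))\<bar> \<le> \<epsilon> / 4 + Re (ip (\<tau> i) (?N (f i)) (?N (f i))) / \<epsilon>"
      using abs_ip_le[OF \<tau>(1) N one_carrier_mat, of "\<epsilon> / 2" i "f i"] \<epsilon> by simp
    from mult_left_mono[OF this p(1)[of i]] show ?thesis
      using p(1)[of i] by (simp add: abs_mult distrib_left)
  qed
  then have "(\<Sum>i<K. \<bar>p i * Re (mtrace (?N (f i) * \<tau> i))\<bar>) \<le>
      (\<Sum>i<K. p i * (\<epsilon> / 4) + p i * Re (ip (\<tau> i) (?N (f i)) (?N (f i))) / \<epsilon>)"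
    by (rule sum_mono)
  also have "\<dots> = (\<Sum>i<K. p i) * (\<epsilon> / 4) + (\<Sum>i<K. p i * Re (ip (\<tau> i) (?N (f i)) (?N (f i)))) / \<epsilon>"
    by (simp add: sum.distrib sum_distrib_right sum_divide_distrib)
  also have "\<dots> \<le> 1 * (\<epsilon> / 4) + (\<epsilon>\<^sup>2 / 4) / \<epsilon>"
  proof (intro add_mono mult_right_mono divide_right_mono B)
    show "(\<Sum>i<K. p i) \<le> 1"
      using sum_le_suminf[of p "{..<K}"] p by (auto simp: sums_iff)
  qed (use \<epsilon> in auto)
  also have "\<dots> = \<epsilon> / 2" using \<epsilon> by (simp add: power2_eq_square)
  finally show ?thesis .
qed

end

text \<open>The common summand \<open>g\<close> need not be summable: if it is not, neither series is, and both sums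
  have the same junk value.\<close>

lemma abs_suminf_diff_le:
  fixes a b g :: "nat \<Rightarrow> real"
  assumes "\<And>K. (\<Sum>i<K. \<bar>a i\<bar>) \<le> A" "\<And>K. (\<Sum>i<K. \<bar>b i\<bar>) \<le> B"
  shows "\<bar>(\<Sum>i. a i + g i) - (\<Sum>i. b i + g i)\<bar> \<le> A + B"
proof -
  have bound: "summable c" "\<bar>suminf c\<bar> \<le> C" if "\<And>K. (\<Sum>i<K. \<bar>c i\<bar>) \<le> C" for c :: "nat \<Rightarrow> real" and C
  proof -
    have s: "summable (\<lambda>i. \<bar>c i\<bar>)" using that by (intro summableI_nonneg_bounded) auto
    then show "summable c" by (rule summable_rabs_cancel)
    show "\<bar>suminf c\<bar> \<le> C"
      using summable_rabs[OF s] suminf_le_const[OF s] that by (meson order.trans)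
  qed
  have a: "summable a" "\<bar>suminf a\<bar> \<le> A" and b: "summable b" "\<bar>suminf b\<bar> \<le> B"
    using bound[OF assms(1)] bound[OF assms(2)] by auto
  show ?thesis
  proof (cases "summable g")
    case True
    then have "(\<Sum>i. a i + g i) - (\<Sum>i. b i + g i) = suminf a - suminf b"
      using a(1) b(1) by (simp add: suminf_add[symmetric])
    then show ?thesis using a(2) b(2) by linarith
  next
    case False
    have "\<not> summable (\<lambda>i. c i + g i)" if "summable c" for c
      using False summable_diff[OF _ that, of "\<lambda>i. c i + g i"] by auto
    then have "(\<Sum>i. a i + g i) = (\<Sum>i. b i + g i)"
      using a(1) b(1) unfolding suminf_def summable_def by (intro arg_cong[of _ _ The]) auto
    then show ?thesis using a(2) b(2) by linarith
  qed
qed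

theorem theorem4:
  fixes n l :: nat and \<epsilon> t :: real and P :: "bit poly"
  assumes "n \<ge> 1"
    and "0 < \<epsilon>" and "\<epsilon> < 1"
    and "real l = real n - t + 2 * log 2 (1 / \<epsilon>) + 3"
    and "l \<le> 2 * n"
    and "irreducible P" and "degree P = max l (2 * n - l)"
  shows "strongly_ent_secure (2 ^ n) (Rchan n l P) t \<epsilon>"
  unfolding strongly_ent_secure_def
proof (intro allI impI, elim conjE)
  fix dE :: nat and \<phi> p \<tau> and f :: "nat \<Rightarrow> nat" and M
  define d where "d = 2 ^ n * dE"
  define Dc :: nat where "Dc = 2 ^ degree P * 2 ^ (2 * n - l)"
  assume dE: "1 \<le> dE" and "density (2 ^ n * dE) \<phi>" and hm: "t \<le> hmin (2 ^ n) dE \<phi>"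
    and "decomposition (2 ^ n * dE) \<phi> p \<tau>" and M: "povm (dim_row (Rchan n l P dE \<phi>)) M"
  then have \<phi>: "density d \<phi>" and dec: "decomposition d \<phi> p \<tau>" by (simp_all add: d_def)
  have M: "povm (Dc * d) M" using M by (simp add: Rchan_eq d_def Dc_def)
  obtain \<sigma> \<mu> where \<sigma>: "density dE \<sigma>" and le: "psd d (complex_of_real \<mu> \<cdot>\<^sub>m kron (1\<^sub>m (2 ^ n)) \<sigma> - \<phi>)"
    and \<mu>_le: "\<mu> \<le> 2 * 2 powr (- t)"
    using hmin_witness[of "2 ^ n" dE \<phi> t] dE \<phi> hm by (auto simp: d_def)
  have "1 \<le> \<mu> * real (2 ^ n)"
    using feasible_scalar_ge[of "2 ^ n" dE \<phi> \<sigma> \<mu>] \<phi> \<sigma> le by (simp add: d_def)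
  then have \<mu>_nonneg: "0 \<le> \<mu>"
    by (smt (verit) mult_nonpos_nonneg of_nat_0_le_iff)
  \<comment> \<open>Here the key length enters: the exponent 1 - t + n - l equals 2 log \<epsilon> -
    2.\<close>
  have \<mu>: "\<mu> * (2 ^ n / 2 ^ l) \<le> \<epsilon>\<^sup>2 / 4"
  proof -
    have "\<mu> * (2 ^ n / 2 ^ l) \<le> 2 * 2 powr (- t) * (2 ^ n / 2 ^ l)"
      using \<mu>_le by (intro mult_right_mono) auto
    also have "\<dots> = 2 powr (1 - t + real n - real l)"
      by (simp add: powr_add powr_diff powr_minus powr_realpow field_simps)
    also have "1 - t + real n - real l = log 2 \<epsilon> + log 2 \<epsilon> - 2"
      using assms(2,4) by (simp add: log_divide)
    also have "2 powr \<dots> = \<epsilon>\<^sup>2 / 4"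
      unfolding powr_diff powr_add using assms(2) by (simp add: power2_eq_square)
    finally show ?thesis .
  qed
  let ?A = "ptrace_E (2 ^ n) dE \<phi>" let ?E = "ptrace_A (2 ^ n) dE"
  \<comment> \<open>The ideal case as a second interpretation, with the same probabilities, of the
    product of the two reduced states.\<close>
  define \<rho> where "\<rho> i = kron ?A (?E (\<tau> i))" for i
  have \<tau>: "density d (\<tau> i)" for i using dec by (simp add: decomposition_def)
  have \<phi>c: "\<phi> \<in> carrier_mat d d" and \<tau>c: "\<tau> i \<in> carrier_mat d d" for i
    using \<phi> \<tau> by (auto simp: density_def psd_carrier)
  have A: "density (2 ^ n) ?A" using \<phi> by (simp add: density_ptrace_E d_def)
  have E: "density dE (?E \<phi>)" "density dE (?E (\<tau> i))" for i
    using \<phi> \<tau> by (simp_all add: density_ptrace_A d_def)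
  have \<rho>c: "\<rho> i \<in> carrier_mat d d" for i by (simp add: \<rho>_def d_def)
  have dec': "decomposition d (kron ?A (?E \<phi>)) p \<rho>"
    unfolding decomposition_def
  proof (intro conjI allI impI)
    show "0 \<le> p i" "p sums 1" for i using dec by (auto simp: decomposition_def)
    show "density d (\<rho> i)" for i
      unfolding \<rho>_def d_def by (intro density_kron A E)
    fix a b assume "a < d" "b < d"
    then obtain a1 x b1 y where ab: "a1 < 2 ^ n" "x < dE" "a = a1 * dE + x" "b1 < 2 ^ n" "y < dE" "b = b1 * dE + y"
      unfolding d_def by (elim less_multE) blast
    have "(\<lambda>i. complex_of_real (p i) * \<tau> i $$ (c * dE + x, c * dE + y)) sums \<phi> $$ (c * dE + x, c * dE + y)"
      if "c < 2 ^ n" for c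
      using dec that ab by (simp add: decomposition_def d_def mult_add_less_mult)
    then have "(\<lambda>i. ?A $$ (a1, b1) * (\<Sum>c<2 ^ n. complex_of_real (p i) * \<tau> i $$ (c * dE + x, c * dE + y))) sums
        (?A $$ (a1, b1) * (\<Sum>c<2 ^ n. \<phi> $$ (c * dE + x, c * dE + y)))"
      by (intro sums_mult sums_sum) auto
    moreover have "kron ?A (?E X) $$ (a, b) = ?A $$ (a1, b1) * (\<Sum>c<2 ^ n. X $$ (c * dE + x, c * dE + y))" for X
      using ab by (simp add: index_kron[of _ "2 ^ n" "2 ^ n" _ dE dE] ptrace_A_def)
    ultimately show "(\<lambda>i. complex_of_real (p i) * \<rho> i $$ (a, b)) sums kron ?A (?E \<phi>) $$ (a, b)"
      by (simp add: \<rho>_def sum_distrib_left mult_ac)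
  qed
  \<comment> \<open>Tracing out E gives \<phi>^A \<le> \<mu> 1 because \<sigma> has trace 1;
    tensoring with \<phi>^E keeps the inequality. So \<phi>^E takes the role of \<sigma> with
    unchanged \<mu>.\<close>
  have le': "psd d (complex_of_real \<mu> \<cdot>\<^sub>m kron (1\<^sub>m (2 ^ n)) (?E \<phi>) - kron ?A (?E \<phi>))"
  proof -
    have "ptrace_E (2 ^ n) dE (complex_of_real \<mu> \<cdot>\<^sub>m kron (1\<^sub>m (2 ^ n)) \<sigma> - \<phi>) = complex_of_real \<mu> \<cdot>\<^sub>m 1\<^sub>m (2 ^ n) - ?A"
    proof (rule eq_matI)
      fix a b assume "a < dim_row (complex_of_real \<mu> \<cdot>\<^sub>m 1\<^sub>m (2 ^ n) - ?A)" "b < dim_col (complex_of_real \<mu> \<cdot>\<^sub>m 1\<^sub>m (2 ^ n) - ?A)"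
      then have ab: "a < 2 ^ n" "b < 2 ^ n" by (auto simp: ptrace_E_def)
      have \<sigma>c: "\<sigma> \<in> carrier_mat dE dE" "(\<Sum>e<dE. \<sigma> $$ (e, e)) = 1"
        using \<sigma> by (auto simp: density_def mtrace_def dest: psd_carrier)
      have "(complex_of_real \<mu> \<cdot>\<^sub>m kron (1\<^sub>m (2 ^ n)) \<sigma> - \<phi>) $$ (a * dE + e, b * dE + e) =
         complex_of_real \<mu> * (1\<^sub>m (2 ^ n) $$ (a, b) * \<sigma> $$ (e, e)) - \<phi> $$ (a * dE + e, b * dE + e)" if "e < dE" for e
        using ab that \<sigma>c \<phi>c mult_add_less_mult[of a "2 ^ n" e dE] mult_add_less_mult[of b "2 ^ n" e dE]
        by (simp add: index_kron[of _ "2 ^ n" "2 ^ n" _ dE dE] d_def del: index_one_mat(1))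
      then have "ptrace_E (2 ^ n) dE (complex_of_real \<mu> \<cdot>\<^sub>m kron (1\<^sub>m (2 ^ n)) \<sigma> - \<phi>) $$ (a, b) =
        complex_of_real \<mu> * (1\<^sub>m (2 ^ n) $$ (a, b) * (\<Sum>e<dE. \<sigma> $$ (e, e))) - (\<Sum>e<dE. \<phi> $$ (a * dE + e, b * dE + e))"
        using ab by (simp add: ptrace_E_def sum_subtractf sum_distrib_left del: index_one_mat(1))
      then show "ptrace_E (2 ^ n) dE (complex_of_real \<mu> \<cdot>\<^sub>m kron (1\<^sub>m (2 ^ n)) \<sigma> - \<phi>) $$ (a, b) =
          (complex_of_real \<mu> \<cdot>\<^sub>m 1\<^sub>m (2 ^ n) - ?A) $$ (a, b)"
        using ab \<sigma>c by (simp add: ptrace_E_def)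
    qed (auto simp: ptrace_E_def)
    then have "psd (2 ^ n) (complex_of_real \<mu> \<cdot>\<^sub>m 1\<^sub>m (2 ^ n) - ?A)"
      using psd_ptrace_E[of "2 ^ n" dE] le by (metis d_def)
    then have "psd d (kron (complex_of_real \<mu> \<cdot>\<^sub>m 1\<^sub>m (2 ^ n) - ?A) (?E \<phi>))"
      using E(1) by (simp add: d_def psd_kron density_def)
    then show ?thesis
      by (simp add: kron_minus_left[of _ "2 ^ n" "2 ^ n" _ _ dE dE] kron_smult_left)
  qed
  \<comment> \<open>The twirled contribution, written with \<open>\<tau> i\<close> but shared with
    \<open>\<rho> i\<close>, whose twirl is the same.\<close>
  define g where "g i = p i * Re ((\<Sum>w\<in>public_strings n l P.
    mtrace (submat d (\<lambda>a. public_index w * d + a) (M (f i)) * twirl n dE (\<tau> i))) / of_nat Dc)" for i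
  have Mc: "M y \<in> carrier_mat (Dc * d) (Dc * d)" for y using M by (auto simp: povm_def intro: psd_carrier)
  note tr = mtrace_mult_Rchan[OF assms(5-7), where dE = dE, folded d_def Dc_def, OF Mc]
  have 1: "p i * Re (mtrace (M (f i) * Rchan n l P dE (\<tau> i))) =
      p i * Re (mtrace (centred_effect n l P dE (M (f i)) * \<tau> i)) + g i" for i
    unfolding tr[OF \<tau>c] g_def by (simp only: plus_complex.sel distrib_left)
  have 2: "p i * Re (mtrace (M (f i) * kron (Rchan n l P 1 ?A) (?E (\<tau> i)))) =
      p i * Re (mtrace (centred_effect n l P dE (M (f i)) * \<rho> i)) + g i" for i
  proof -
    have "kron (Rchan n l P 1 ?A) (?E (\<tau> i)) = Rchan n l P dE (\<rho> i)"
      unfolding \<rho>_def by (intro Rchan_kron[OF assms(5-7)]) auto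
    \<comment> \<open>Both have the same reduced state on E, since \<phi>^A has trace 1.\<close>
    moreover have "twirl n dE (\<rho> i) = twirl n dE (\<tau> i)"
    proof (rule twirl_cong_ptrace)
      have "1 \<cdot>\<^sub>m ?E (\<tau> i) = ?E (\<tau> i)" by (intro eq_matI) auto
      then show "?E (\<rho> i) = ?E (\<tau> i)"
        unfolding \<rho>_def using A by (simp add: ptrace_A_kron density_def)
    qed (use \<rho>c \<tau>c in \<open>auto simp: d_def\<close>)
    ultimately show ?thesis
      unfolding g_def by (simp only: tr[OF \<rho>c] plus_complex.sel distrib_left)
  qed
  have Ec: "kron ?A (?E \<phi>) \<in> carrier_mat d d" by (simp add: d_def)
  note bound = sum_abs_mtrace_centred_le[OF assms(5-7), where dE = dE, folded d_def Dc_def,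
      OF _ M _ _ _ assms(2) \<mu>_nonneg \<mu>]
  \<comment> \<open>The same estimate is used twice, with weights \<sigma> and \<phi>^E.\<close>
  have "\<bar>(\<Sum>i. p i * Re (mtrace (centred_effect n l P dE (M (f i)) * \<tau> i)) + g i) -
      (\<Sum>i. p i * Re (mtrace (centred_effect n l P dE (M (f i)) * \<rho> i)) + g i)\<bar> \<le> \<epsilon> / 2 + \<epsilon> / 2"
    by (rule abs_suminf_diff_le[OF bound[OF \<sigma> \<phi>c le dec] bound[OF E(1) Ec le' dec']])
  then show "\<bar>(\<Sum>i. p i * Re (mtrace (M (f i) * Rchan n l P dE (\<tau> i)))) -
      (\<Sum>i. p i * Re (mtrace (M (f i) * kron (Rchan n l P 1 ?A) (?E (\<tau> i)))))\<bar> \<le> \<epsilon>"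
    unfolding 1 2 by simp
qed

end
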